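(* Let $(V,g)$ be an oriented Euclidean real vector space of dimension $n$. For $1\le p\le k\le n$ and $\omega\in\mathcal C_1^p$, $$\frac{1}{(k-p)!}*(g^{k-p}\omega)=\sum_{r=\max\{0,p-n+k\}}^{p}\frac{(-1)^{r+p}}{r!}\,\frac{g^{n-k-p+r}}{(n-k-p+r)!}\,c^r\omega .$$ In particular, for $k=n$, $$*\Big(\frac{g^{n-p}\omega}{(n-p)!}\Big)=\frac{1}{p!}c^p\omega,$$ and for $k=n-1$ (when $p\le n-1$), $$*\Big(\frac{g^{n-p-1}\omega}{(n-p-1)!}\Big)=\frac{c^p\omega}{p!}\,g-\frac{c^{p-1}\omega}{(p-1)!}.$$
   Context: $D^{p,q}=\Lambda^pV^*\otimes\Lambda^qV^*$, identified with bilinear forms $\Lambda^pV\times\Lambda^qV\to\mathbb R$ (wedges of distinct elements of a dual basis evaluate to $1$ on the corresponding wedges of basis vectors). The product is $(\theta_1\otimes\theta_2)\cdot(\theta_3\otimes\theta_4)=(\theta_1\wedge\theta_3)\otimes(\theta_2\wedge\theta_4)$, and $g=\sum_{i=1}^n e_i\otimes e_i\in D^{1,1}$ for an orthonormal basis $(e_i)$ of $V^*$. The contraction $c:D^{p,q}\to D^{p-1,q-1}$ is $c\omega(x_1\wedge\dots\wedge x_{p-1},y_1\wedge\dots\wedge y_{q-1})=\sum_{j=1}^n\omega(e_j\wedge x_1\wedge\dots,e_j\wedge y_1\wedge\dots)$ with $(e_j)$ an orthonormal basis of $V$ ($c\omega=0$ if $p=0$ or $q=0$). The Hodge star $*:D^{p,q}\to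 D^{n-p,n-q}$ is $*(\theta_1\otimes\theta_2)=*\theta_1\otimes*\theta_2$. The first Bianchi sum $\mathcal B:D^{p,q}\to D^{p+1,q-1}$ is $\mathcal B\omega(x_1\wedge\dots\wedge x_{p+1},y_1\wedge\dots\wedge y_{q-1})=\sum_{j=1}^{p+1}(-1)^j\omega(x_1\wedge\dots\wedge\hat x_j\wedge\dots\wedge x_{p+1},x_j\wedge y_1\wedge\dots\wedge y_{q-1})$ ($\mathcal B\omega=0$ if $q=0$). $\mathcal C_1^p$ is the space of symmetric elements $\omega$ of $D^{p,p}$ with $\mathcal B\omega=0$. *)

theory Defs
  imports "HOL-Analysis.Analysis"
begin

text \<open>
  The oriented Euclidean space \<open>V\<close> is a type of class \<^class>\<open>euclidean_space\<close>, with \<open>n = DIM('a)\<close>,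
  together with the unit volume form of its orientation.  A form is a function on lists of
  vectors; an element of \<open>\<Lambda>\<^sup>pV*\<close> vanishes on lists of length other than \<open>p\<close>, so that functions on
  all lists represent sums of forms of different degrees and the operations below need no degree
  arguments.  By the universal property of \<open>\<Lambda>\<^sup>pV\<close>, a bilinear form on \<open>\<Lambda>\<^sup>pV \<times> \<Lambda>\<^sup>qV\<close> is the same as a
  function \<open>\<omega> [x\<^sub>1,\<dots>,x\<^sub>p] [y\<^sub>1,\<dots>,y\<^sub>q]\<close> that is multilinear and alternating in the \<open>x\<close>s and in the \<open>y\<close>s.
\<close>

type_synonym 'a form = "'a list \<Rightarrow> real"
type_synonym 'a dform = "'a list \<Rightarrow> 'a list \<Rightarrow> real"

definition alt_forms :: "nat \<Rightarrow> 'a::euclidean_space form set" where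
  "alt_forms p = {\<alpha>.
     (\<forall>xs. length xs \<noteq> p \<longrightarrow> \<alpha> xs = 0) \<and>
     (\<forall>xs i. length xs = p \<and> i < p \<longrightarrow> linear (\<lambda>v. \<alpha> (xs[i := v]))) \<and>
     (\<forall>xs. length xs = p \<and> \<not> distinct xs \<longrightarrow> \<alpha> xs = 0)}"

definition double_forms :: "nat \<Rightarrow> nat \<Rightarrow> 'a::euclidean_space dform set" where
  "double_forms p q = {\<omega>.
     (\<forall>ys. (\<lambda>xs. \<omega> xs ys) \<in> alt_forms p) \<and> (\<forall>xs. (\<lambda>ys. \<omega> xs ys) \<in> alt_forms q)}"

definition tensor :: "'a form \<Rightarrow> 'a form \<Rightarrow> 'a dform" where
  "tensor \<alpha> \<beta> xs ys = \<alpha> xs * \<beta> ys"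

text \<open>
  Sign of the shuffle that lists the positions in \<open>A\<close> first and the other positions below \<open>m\<close>
  after them, both in increasing order.
\<close>

definition shuffle_sign :: "nat \<Rightarrow> nat set \<Rightarrow> real" where
  "shuffle_sign m A = (- 1) ^ card {(i, j). i \<in> A \<and> j < m \<and> j \<notin> A \<and> j < i}"

text \<open>
  The wedge product is the sum over shuffles without further factor, so that wedges of distinct
  elements of a dual basis take the value 1 on the corresponding basis vectors.  When \<open>\<alpha>\<close> and \<open>\<beta>\<close>
  have degrees \<open>p\<close> and \<open>q\<close>, only the sets \<open>A\<close> with \<open>p\<close> elements contribute.
\<close>

definition wedge :: "'a form \<Rightarrow> 'a form \<Rightarrow> 'a form" where
  "wedge \<alpha> \<beta> xs = (\<Sum>A\<in>Pow {..<length xs}.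
     shuffle_sign (length xs) A * \<alpha> (nths xs A) * \<beta> (nths xs (- A)))"

text \<open>
  The product of double forms is the bilinear extension of
  \<open>(\<theta>\<^sub>1 \<otimes> \<theta>\<^sub>2) \<cdot> (\<theta>\<^sub>3 \<otimes> \<theta>\<^sub>4) = (\<theta>\<^sub>1 \<and> \<theta>\<^sub>3) \<otimes> (\<theta>\<^sub>2 \<and> \<theta>\<^sub>4)\<close>; see \<open>dmult_tensor\<close>.
\<close>

definition dmult :: "'a dform \<Rightarrow> 'a dform \<Rightarrow> 'a dform" where
  "dmult \<omega> \<eta> xs ys = (\<Sum>A\<in>Pow {..<length xs}. \<Sum>B\<in>Pow {..<length ys}.
     shuffle_sign (length xs) A * shuffle_sign (length ys) B *
     \<omega> (nths xs A) (nths ys B) * \<eta> (nths xs (- A)) (nths ys (- B)))"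

lemma dmult_tensor:
  "dmult (tensor \<theta>1 \<theta>2) (tensor \<theta>3 \<theta>4) = tensor (wedge \<theta>1 \<theta>3) (wedge \<theta>2 \<theta>4)"
  by (intro ext) (simp add: dmult_def tensor_def wedge_def sum_product mult_ac)

definition dunit :: "'a dform" where
  "dunit xs ys = (if xs = [] \<and> ys = [] then 1 else 0)"

primrec dpow :: "'a dform \<Rightarrow> nat \<Rightarrow> 'a dform" where
  "dpow \<omega> 0 = dunit"
| "dpow \<omega> (Suc m) = dmult \<omega> (dpow \<omega> m)"

definition covector :: "'a::euclidean_space \<Rightarrow> 'a form" where
  "covector b xs = (case xs of [x] \<Rightarrow> b \<bullet> x | _ \<Rightarrow> 0)"

text \<open>
  The metric, the contraction and the Hodge star do not depend on the orthonormal basis used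
  to define them; the basis below is the one fixed by the type class.
\<close>

definition metric_form :: "'a::euclidean_space dform" where
  "metric_form xs ys = (\<Sum>b\<in>Basis. tensor (covector b) (covector b) xs ys)"

lemma metric_form_apply: "metric_form [x] [y] = x \<bullet> y"
  by (simp add: metric_form_def tensor_def covector_def euclidean_inner[of x y] inner_commute)

text \<open>
  On \<open>D\<^sup>p\<^sup>,\<^sup>q\<close> with \<open>p = 0\<close> or \<open>q = 0\<close> the contraction is 0, because \<open>\<omega>\<close> vanishes on lists of the wrong
  length; likewise the Bianchi sum for \<open>q = 0\<close>.
\<close>

definition contraction :: "'a::euclidean_space dform \<Rightarrow> 'a dform" where
  "contraction \<omega> xs ys = (\<Sum>b\<in>Basis. \<omega> (b # xs) (b # ys))"

text \<open>List positions start at 0, hence the exponent \<open>Suc j\<close>.\<close>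

definition bianchi :: "'a dform \<Rightarrow> 'a dform" where
  "bianchi \<omega> xs ys = (\<Sum>j<length xs.
     (- 1) ^ Suc j * \<omega> (take j xs @ drop (Suc j) xs) (xs ! j # ys))"

definition C1 :: "nat \<Rightarrow> 'a::euclidean_space dform set" where
  "C1 p = {\<omega> \<in> double_forms p p.
     (\<forall>xs ys. \<omega> xs ys = \<omega> ys xs) \<and> (\<forall>xs ys. bianchi \<omega> xs ys = 0)}"

text \<open>
  An orientation of \<open>V\<close> is given by its unit volume form, which is 1 on the positively oriented
  and -1 on the negatively oriented orthonormal bases.
\<close>

definition unit_volume_form :: "'a::euclidean_space form \<Rightarrow> bool" where
  "unit_volume_form vol \<longleftrightarrow> vol \<in> alt_forms DIM('a) \<and>
     (\<forall>es. length es = DIM('a) \<and>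
           (\<forall>i<DIM('a). \<forall>j<DIM('a). es ! i \<bullet> es ! j = (if i = j then 1 else 0))
        \<longrightarrow> \<bar>vol es\<bar> = 1)"

text \<open>
  The Hodge star with \<open>\<alpha> \<and> *\<theta> = \<langle>\<alpha>, \<theta>\<rangle> vol\<close>, that is,
  \<open>*(e\<^sub>1 \<and> \<dots> \<and> e\<^sub>p) = vol(e\<^sub>1, \<dots>, e\<^sub>p, -)\<close> for orthonormal \<open>e\<^sub>1, \<dots>, e\<^sub>p\<close>.  Each set of \<open>p\<close> basis vectors
  is counted \<open>p!\<close> times in the sum below.  A value on a list \<open>xs\<close> only involves the component
  of \<open>\<theta>\<close> of degree \<open>p = n - length xs\<close>, and is 0 when \<open>length xs > n\<close>.
\<close>

definition basis_lists :: "nat \<Rightarrow> 'a::euclidean_space list set" where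
  "basis_lists p = {bs. set bs \<subseteq> Basis \<and> length bs = p}"

definition hodge :: "'a::euclidean_space form \<Rightarrow> 'a form \<Rightarrow> 'a form" where
  "hodge vol \<theta> xs = (let p = DIM('a) - length xs in
     (\<Sum>bs\<in>basis_lists p. \<theta> bs * vol (bs @ xs)) / fact p)"

text \<open>The linear extension of \<open>*(\<theta>\<^sub>1 \<otimes> \<theta>\<^sub>2) = *\<theta>\<^sub>1 \<otimes> *\<theta>\<^sub>2\<close>; see \<open>dhodge_tensor\<close>.\<close>

definition dhodge :: "'a::euclidean_space form \<Rightarrow> 'a dform \<Rightarrow> 'a dform" where
  "dhodge vol \<omega> xs ys = (let p = DIM('a) - length xs; q = DIM('a) - length ys in
     (\<Sum>bs\<in>basis_lists p. \<Sum>cs\<in>basis_lists q.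
        \<omega> bs cs * vol (bs @ xs) * vol (cs @ ys)) / (fact p * fact q))"

lemma dhodge_tensor:
  "dhodge vol (tensor \<theta>1 \<theta>2) = tensor (hodge vol \<theta>1) (hodge vol \<theta>2)"
  by (intro ext) (simp add: dhodge_def hodge_def tensor_def Let_def sum_product mult_ac)

end

theory Submission
  imports Defs
begin

text \<open>
  Up to a factorial, \<open>g\<^sup>m\<close> evaluated on lists of length \<open>m\<close> is the Gram determinant, and
  \<open>vol(x) vol(y)\<close> is the Gram determinant of \<open>x\<close> and \<open>y\<close>.  This turns the Hodge star of \<open>g\<^sup>k\<^sup>-\<^sup>p \<omega>\<close>
  into a pairing of \<open>\<omega>\<close> with \<open>p\<close> extra rows and columns of a Gram determinant.  Expanding along
  an extra row, either the column is an extra one as well, which contracts \<open>\<omega>\<close>, or it is one of the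
  arguments, which is then inserted into \<open>\<omega>\<close>.  The resulting recursion is solved by induction on
  \<open>p\<close> over forms of all bidegrees \<open>(p, q)\<close>: the transposed contraction sum satisfies it
  term by term because \<open>p = r + (p - r)\<close>, where the part \<open>p - r\<close> comes from Euler's identity for the
  degree of \<open>c\<^sup>r \<omega>\<close>.  The transpose disappears by the symmetry of \<open>\<omega>\<close>.
\<close>

section \<open>Alternating sums over deletions and shuffles\<close>

text \<open>
  \<open>del_sum [y\<^sub>0,\<dots>,y\<^sub>m] f\<close> is the sum of \<open>(-1)\<^sup>j f y\<^sub>j [y\<^sub>0,\<dots>,y\<^sub>m without y\<^sub>j]\<close>, and \<open>shuffle_sum\<close> is
  the signed sum over splittings in the definition of the wedge product (\<open>shuffle_sum_eq\<close>).
\<close>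

primrec del_sum :: "'a list \<Rightarrow> ('a \<Rightarrow> 'a list \<Rightarrow> real) \<Rightarrow> real" where
  "del_sum [] f = 0"
| "del_sum (y # ys) f = f y ys - del_sum ys (\<lambda>z zs. f z (y # zs))"

primrec shuffle_sum :: "'a list \<Rightarrow> ('a list \<Rightarrow> 'a list \<Rightarrow> real) \<Rightarrow> real" where
  "shuffle_sum [] \<Phi> = \<Phi> [] []"
| "shuffle_sum (x # xs) \<Phi> =
     shuffle_sum xs (\<lambda>u v. \<Phi> (x # u) v) + shuffle_sum xs (\<lambda>u v. (- 1) ^ length u * \<Phi> u (x # v))"

lemma del_sum_cong:
  assumes "\<And>z zs. Suc (length zs) = length ys \<Longrightarrow> f z zs = g z zs"
  shows "del_sum ys f = del_sum ys g"
  using assms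
proof (induction ys arbitrary: f g)
  case (Cons y ys)
  have "del_sum ys (\<lambda>z zs. f z (y # zs)) = del_sum ys (\<lambda>z zs. g z (y # zs))"
    by (rule Cons.IH) (simp add: Cons.prems)
  then show ?case using Cons.prems by simp
qed simp

lemma shuffle_sum_cong:
  assumes "\<And>u v. length u + length v = length xs \<Longrightarrow> \<Phi> u v = \<Psi> u v"
  shows "shuffle_sum xs \<Phi> = shuffle_sum xs \<Psi>"
  using assms
proof (induction xs arbitrary: \<Phi> \<Psi>)
  case (Cons x xs)
  have "shuffle_sum xs (\<lambda>u v. \<Phi> (x # u) v) = shuffle_sum xs (\<lambda>u v. \<Psi> (x # u) v)"
    by (rule Cons.IH) (simp add: Cons.prems)
  moreover have "shuffle_sum xs (\<lambda>u v. (- 1) ^ length u * \<Phi> u (x # v))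
      = shuffle_sum xs (\<lambda>u v. (- 1) ^ length u * \<Psi> u (x # v))"
    by (rule Cons.IH) (simp add: Cons.prems)
  ultimately show ?case by simp
qed simp

lemma del_sum_add: "del_sum ys (\<lambda>z zs. f z zs + g z zs) = del_sum ys f + del_sum ys g"
  by (induction ys arbitrary: f g) auto

lemma del_sum_mult: "del_sum ys (\<lambda>z zs. c * f z zs) = c * del_sum ys f"
  by (induction ys arbitrary: f) (auto simp: algebra_simps)

lemma del_sum_minus: "del_sum ys (\<lambda>z zs. - f z zs) = - del_sum ys f"
  using del_sum_mult[of ys "-1" f] by simp

lemma del_sum_0:
  assumes "\<And>z zs. Suc (length zs) = length ys \<Longrightarrow> f z zs = 0"
  shows "del_sum ys f = 0"
  using del_sum_cong[of ys f "\<lambda>z zs. 0 * f z zs"] assms del_sum_mult[of ys 0 f] by simp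

lemma del_sum_sum: "del_sum ys (\<lambda>z zs. \<Sum>i\<in>I. f i z zs) = (\<Sum>i\<in>I. del_sum ys (f i))"
  by (induction ys arbitrary: f) (auto simp: sum_subtractf)

lemma del_sum_linear:
  assumes "\<And>z zs. linear (\<lambda>t. f t z zs)"
  shows "linear (\<lambda>t. del_sum ys (f t))"
proof (rule linearI)
  show "del_sum ys (f (s + t)) = del_sum ys (f s) + del_sum ys (f t)" for s t
    unfolding del_sum_add[symmetric] by (rule del_sum_cong) (rule linear_add[OF assms])
  show "del_sum ys (f (c *\<^sub>R t)) = c *\<^sub>R del_sum ys (f t)" for c t

    unfolding real_scaleR_def del_sum_mult[symmetric]
    by (rule del_sum_cong) (simp add: linear_scale[OF assms])
qed

lemma del_sum_append:
  "del_sum (xs @ ys) f = del_sum xs (\<lambda>z zs. f z (zs @ ys))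
     + (- 1) ^ length xs * del_sum ys (\<lambda>z zs. f z (xs @ zs))"
  by (induction xs arbitrary: f) auto

lemma del_sum_swap:
  "del_sum xs (\<lambda>z zs. del_sum ys (\<lambda>w ws. f z zs w ws))
     = del_sum ys (\<lambda>w ws. del_sum xs (\<lambda>z zs. f z zs w ws))"
proof (induction xs arbitrary: f)
  case Nil
  then show ?case using del_sum_mult[of ys 0 "\<lambda>_ _. 0"] by simp
next
  case (Cons x xs)
  then show ?case
    using del_sum_add[of ys "f x xs" "\<lambda>w ws. - del_sum xs (\<lambda>z zs. f z (x # zs) w ws)"]
    by (simp add: del_sum_minus)
qed

lemma shuffle_sum_add:
  "shuffle_sum xs (\<lambda>u v. \<Phi> u v + \<Psi> u v) = shuffle_sum xs \<Phi> + shuffle_sum xs \<Psi>"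
  by (induction xs arbitrary: \<Phi> \<Psi>) (auto simp: distrib_left)

lemma shuffle_sum_mult: "shuffle_sum xs (\<lambda>u v. c * \<Phi> u v) = c * shuffle_sum xs \<Phi>"
proof (induction xs arbitrary: \<Phi>)
  case (Cons x xs)
  have "shuffle_sum xs (\<lambda>u v. (- 1) ^ length u * (c * \<Phi> u (x # v)))
      = c * shuffle_sum xs (\<lambda>u v. (- 1) ^ length u * \<Phi> u (x # v))"
    unfolding Cons.IH[symmetric] by (simp add: mult_ac)
  then show ?case by (simp add: Cons.IH distrib_left)
qed simp

lemma shuffle_sum_minus: "shuffle_sum xs (\<lambda>u v. - \<Phi> u v) = - shuffle_sum xs \<Phi>"
  using shuffle_sum_mult[of xs "-1" \<Phi>] by simp

lemma shuffle_sum_0: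
  assumes "\<And>u v. length u + length v = length xs \<Longrightarrow> \<Phi> u v = 0"
  shows "shuffle_sum xs \<Phi> = 0"
  using shuffle_sum_cong[of xs \<Phi> "\<lambda>u v. 0 * \<Phi> u v"] assms shuffle_sum_mult[of xs 0 \<Phi>] by simp

lemma del_sum_shuffle_sum_swap:
  "del_sum ys (\<lambda>z zs. shuffle_sum xs (\<lambda>u v. f z zs u v))
     = shuffle_sum xs (\<lambda>u v. del_sum ys (\<lambda>z zs. f z zs u v))"
  by (induction xs arbitrary: f) (auto simp: del_sum_add del_sum_mult)

text \<open>Only the splitting with empty left part survives, and its sign is 1. This is
  multiplication by a form of degree 0.\<close>

lemma shuffle_sum_Nil_left:
  "shuffle_sum xs (\<lambda>u v. if u = [] then f v else 0) = f xs"
proof (induction xs arbitrary: f)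
  case (Cons x xs)
  have "shuffle_sum xs (\<lambda>u v. (- 1) ^ length u * (if u = [] then f (x # v) else 0)) = f (x # xs)"
    unfolding Cons.IH[of "\<lambda>v. f (x # v)", symmetric] by (rule shuffle_sum_cong) auto
  then show ?case by (simp add: shuffle_sum_0)
qed simp

text \<open>Moving a block of \<open>length u\<close> entries past one of \<open>length v\<close>
  entries takes \<open>length u * length v\<close> transpositions. This is the graded commutativity
  of the wedge product.\<close>

lemma shuffle_sum_flip:
  "shuffle_sum xs (\<lambda>u v. \<Phi> v u) = shuffle_sum xs (\<lambda>u v. (- 1) ^ (length u * length v) * \<Phi> u v)"
proof (induction xs arbitrary: \<Phi>)
  case (Cons x xs)
  have 1: "shuffle_sum xs (\<lambda>u v. \<Phi> v (x # u))
      = shuffle_sum xs (\<lambda>u v. (- 1) ^ length u * ((- 1) ^ (length u * Suc (length v)) * \<Phi> u (x # v)))"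
    unfolding Cons.IH[of "\<lambda>u v. \<Phi> u (x # v)"]
    by (rule shuffle_sum_cong) (simp flip: power_add mult.assoc add: uminus_power_if)
  have 2: "shuffle_sum xs (\<lambda>u v. (- 1) ^ length u * \<Phi> (x # v) u)
      = shuffle_sum xs (\<lambda>u v. (- 1) ^ (Suc (length u) * length v) * \<Phi> (x # u) v)"
    unfolding Cons.IH[of "\<lambda>u v. (- 1) ^ length v * \<Phi> (x # u) v"]
    by (rule shuffle_sum_cong) (simp flip: power_add mult.assoc add: uminus_power_if)
  show ?case by (simp add: 1 2)
qed simp

text \<open>A splitting whose left part is a single entry is a deletion, with the same sign. This
  handles products with forms of degree 1.\<close>

lemma shuffle_sum_singleton:
  "shuffle_sum xs (\<lambda>u v. case u of [x] \<Rightarrow> f x v | _ \<Rightarrow> 0) = del_sum xs f"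
proof (induction xs arbitrary: f)
  case (Cons x xs)
  have "shuffle_sum xs (\<lambda>u v. case x # u of [y] \<Rightarrow> f y v | _ \<Rightarrow> 0)
      = shuffle_sum xs (\<lambda>u v. if u = [] then f x v else 0)"
    by (rule shuffle_sum_cong) (simp split: list.split)
  moreover have "shuffle_sum xs (\<lambda>u v. (- 1) ^ length u * (case u of [y] \<Rightarrow> f y (x # v) | _ \<Rightarrow> 0))
      = shuffle_sum xs (\<lambda>u v. - (case u of [y] \<Rightarrow> f y (x # v) | _ \<Rightarrow> 0))"
    by (rule shuffle_sum_cong) (simp split: list.split)
  ultimately show ?case
    by (simp add: Cons.IH shuffle_sum_minus shuffle_sum_Nil_left)
qed simp

text \<open>The sign counts inversions, and shifting all positions by one keeps the old ones. If the
  new position 0 is not in the set, it forms one new inversion with each element of the set; if it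
  is, it forms none.\<close>

lemma shuffle_sign_Suc_image:
  assumes "A \<subseteq> {..<m}"
  shows "shuffle_sign (Suc m) (Suc ` A) = (- 1) ^ card A * shuffle_sign m A"
    and "shuffle_sign (Suc m) (insert 0 (Suc ` A)) = shuffle_sign m A"
proof -
  let ?P = "{(i, j). i \<in> A \<and> j < m \<and> j \<notin> A \<and> j < i}"
  have fA: "finite A" using assms finite_subset by blast
  have fin: "finite ?P"
    by (rule finite_subset[of _ "A \<times> {..<m}"]) (use fA in auto)
  have inj: "inj_on (map_prod Suc Suc) ?P" by (auto simp: inj_on_def)
  have e: "{(i, j). i \<in> Suc ` A \<and> j < Suc m \<and> j \<notin> Suc ` A \<and> j < i}
      = (\<lambda>i. (Suc i, 0)) ` A \<union> map_prod Suc Suc ` ?P" (is "?L = ?R")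
  proof
    show "?L \<subseteq> ?R"
    proof clarify
      fix i j assume "j < Suc m" "j \<notin> Suc ` A" "j < Suc i" "i \<in> A"
        "(Suc i, j) \<notin> map_prod Suc Suc ` ?P"
      then show "(Suc i, j) \<in> (\<lambda>i. (Suc i, 0)) ` A" by (cases j) (auto simp: image_iff)
    qed
  qed (use assms in auto)
  have "card ((\<lambda>i. (Suc i, 0::nat)) ` A) = card A" by (rule card_image) (auto simp: inj_on_def)
  then have "card {(i, j). i \<in> Suc ` A \<and> j < Suc m \<and> j \<notin> Suc ` A \<and> j < i} = card A + card ?P"
    unfolding e by (subst card_Un_disjoint) (use fA fin in \<open>auto simp: card_image[OF inj]\<close>)
  then show "shuffle_sign (Suc m) (Suc ` A) = (- 1) ^ card A * shuffle_sign m A"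
    by (simp add: shuffle_sign_def power_add)
  have e: "{(i, j). i \<in> insert 0 (Suc ` A) \<and> j < Suc m \<and> j \<notin> insert 0 (Suc ` A) \<and> j < i}
      = map_prod Suc Suc ` ?P" (is "?L = ?R")
  proof
    show "?L \<subseteq> ?R"
    proof
      fix x assume "x \<in> ?L"
      then show "x \<in> ?R" by (cases x; cases "snd x") (auto simp: image_iff)
    qed
  qed auto
  show "shuffle_sign (Suc m) (insert 0 (Suc ` A)) = shuffle_sign m A"
    unfolding shuffle_sign_def e by (simp add: card_image[OF inj])
qed

lemma shuffle_sum_eq:
  "(\<Sum>A\<in>Pow {..<length xs}. shuffle_sign (length xs) A * \<Phi> (nths xs A) (nths xs (- A)))
     = shuffle_sum xs \<Phi>"
proof (induction xs arbitrary: \<Phi>)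
  case Nil
  then show ?case by (simp add: shuffle_sign_def)
next
  case (Cons x xs)
  let ?m = "length xs"
  define t where "t A = shuffle_sign (Suc ?m) A * \<Phi> (nths (x # xs) A) (nths (x # xs) (- A))" for A
  \<comment> \<open>The sets without 0 put \<open>x\<close> into the right part and the sets with 0
    put it into the left part; these are the two summands of \<open>shuffle_sum\<close>.\<close>
  have pow: "Pow {..<Suc ?m} = (`) Suc ` Pow {..<?m} \<union> (\<lambda>A. insert 0 (Suc ` A)) ` Pow {..<?m}"

    unfolding lessThan_Suc_eq_insert_0 Pow_insert
    by (simp add: image_image flip: image_Pow_surj[OF refl])
  have inj: "inj_on ((`) Suc) (Pow {..<?m})" "inj_on (\<lambda>A. insert 0 (Suc ` A)) (Pow {..<?m})"
    by (auto simp: inj_on_def)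
  have "sum t (Pow {..<Suc ?m})
      = (\<Sum>A\<in>Pow {..<?m}. t (Suc ` A)) + (\<Sum>A\<in>Pow {..<?m}. t (insert 0 (Suc ` A)))"
    unfolding pow by (subst sum.union_disjoint) (auto simp: sum.reindex[OF inj(1)] sum.reindex[OF inj(2)])
  also have "(\<Sum>A\<in>Pow {..<?m}. t (insert 0 (Suc ` A))) = shuffle_sum xs (\<lambda>u v. \<Phi> (x # u) v)"
    unfolding Cons.IH[symmetric]
    by (rule sum.cong) (auto simp: t_def nths_Cons shuffle_sign_Suc_image(2) Compl_eq inj_image_mem_iff)
  also have "(\<Sum>A\<in>Pow {..<?m}. t (Suc ` A)) = shuffle_sum xs (\<lambda>u v. (- 1) ^ length u * \<Phi> u (x # v))"
    unfolding Cons.IH[symmetric]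
  proof (rule sum.cong)
    fix A assume A: "A \<in> Pow {..<?m}"
    then have "{i. i < length xs \<and> i \<in> A} = A" by auto
    then show "t (Suc ` A) = shuffle_sign ?m A * ((- 1) ^ length (nths xs A) * \<Phi> (nths xs A) (x # nths xs (- A)))"
      using A by (auto simp: t_def nths_Cons shuffle_sign_Suc_image(1) Compl_eq length_nths inj_image_mem_iff)
  qed simp
  finally show ?case by (simp add: t_def)
qed

lemma dmult_shuffle_sum:
  "dmult \<omega> \<eta> xs ys = shuffle_sum xs (\<lambda>u u'. shuffle_sum ys (\<lambda>v v'. \<omega> u v * \<eta> u' v'))"
  unfolding dmult_def shuffle_sum_eq[symmetric] by (simp add: sum_distrib_left mult_ac)

section \<open>Skew-symmetric forms\<close>

text \<open>Only adjacent exchanges are mentioned and no degree is fixed, so the property passes at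
  once to forms with some arguments held fixed.\<close>

definition skew :: "'a form \<Rightarrow> bool" where
  "skew \<alpha> \<longleftrightarrow> (\<forall>l a b r. \<alpha> (l @ a # b # r) = - \<alpha> (l @ b # a # r))"

definition multilinear :: "'a::real_vector form \<Rightarrow> bool" where
  "multilinear \<alpha> \<longleftrightarrow> (\<forall>l r. linear (\<lambda>v. \<alpha> (l @ v # r)))"

lemma skew_Cons: "skew \<alpha> \<Longrightarrow> skew (\<lambda>xs. \<alpha> (x # xs))"
  unfolding skew_def by (metis append_Cons)

lemma skew_append: "skew \<alpha> \<Longrightarrow> skew (\<lambda>xs. \<alpha> (xs @ ys))"
  unfolding skew_def append_assoc append_Cons by blast

lemma skew_swap_hd: "skew \<alpha> \<Longrightarrow> \<alpha> (a # b # r) = - \<alpha> (b # a # r)"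
  unfolding skew_def by (metis append_Nil)

lemma skew_move_to_hd: "skew \<alpha> \<Longrightarrow> \<alpha> (l @ a # r) = (- 1) ^ length l * \<alpha> (a # l @ r)"
proof (induction l arbitrary: \<alpha>)
  case (Cons b l)
  show ?case
    using Cons.IH[OF skew_Cons[OF Cons.prems, of b]] skew_swap_hd[OF Cons.prems, of b a "l @ r"]
    by simp
qed simp

text \<open>Moving the second copy of the repeated entry next to the first changes at most the sign,
  and a value with two equal neighbours is its own negative.\<close>

lemma skew_not_distinct:
  assumes "skew \<alpha>" "\<not> distinct xs"
  shows "\<alpha> xs = 0"
proof -
  obtain l m r a where xs: "xs = l @ [a] @ m @ [a] @ r"
    using not_distinct_decomp[OF assms(2)] by blast
  let ?\<alpha> = "\<lambda>zs. \<alpha> (l @ a # zs)"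
  have sk: "skew ?\<alpha>" using assms(1) unfolding skew_def by (metis append_Cons append_assoc)
  have "\<alpha> (l @ a # a # m @ r) = 0" using assms(1) unfolding skew_def by (metis neg_equal_zero)
  then show ?thesis using skew_move_to_hd[OF sk, of m a r] xs by simp
qed

lemma multilinear_Cons:
  assumes "multilinear \<alpha>"
  shows "multilinear (\<lambda>xs. \<alpha> (x # xs))"
  unfolding multilinear_def
  using assms[unfolded multilinear_def, rule_format, of "x # _"] by simp

lemma multilinear_append: "multilinear \<alpha> \<Longrightarrow> multilinear (\<lambda>xs. \<alpha> (xs @ ys))"
  unfolding multilinear_def by auto

lemma linear_expand_Basis:
  fixes f :: "'a::euclidean_space \<Rightarrow> real"
  assumes "linear f"
  shows "(\<Sum>b\<in>Basis. (b \<bullet> z) * f b) = f z"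
proof -
  have "f z = f (\<Sum>b\<in>Basis. (z \<bullet> b) *\<^sub>R b)" by (simp add: euclidean_representation)
  also have "\<dots> = (\<Sum>b\<in>Basis. (b \<bullet> z) * f b)"
    by (simp add: linear_sum[OF assms] linear_scale[OF assms] inner_commute)
  finally show ?thesis by simp
qed

lemma multilinear_expand_Basis:
  assumes "multilinear \<alpha>"
  shows "(\<Sum>b\<in>Basis. (b \<bullet> z) * \<alpha> (b # r)) = \<alpha> (z # r)"
  using assms[unfolded multilinear_def, rule_format, of "[]" r]
    linear_expand_Basis[of "\<lambda>v. \<alpha> (v # r)" z] by simp

lemma alt_forms_degree: "\<alpha> \<in> alt_forms p \<Longrightarrow> length xs \<noteq> p \<Longrightarrow> \<alpha> xs = 0"
  unfolding alt_forms_def by blast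

lemma alt_forms_multilinear:
  assumes "\<alpha> \<in> alt_forms p"
  shows "multilinear \<alpha>"
  unfolding multilinear_def
proof (intro allI)
  fix l r
  show "linear (\<lambda>v. \<alpha> (l @ v # r))"
  \<comment> \<open>The 0 is a placeholder at position \<open>length l\<close>, which the list
    update in \<open>alt_forms\<close> overwrites by \<open>v\<close>.\<close>
  proof (cases "length (l @ 0 # r) = p")
    case True
    then have "length (l @ 0 # r) = p \<and> length l < p" by auto
    then have "linear (\<lambda>v. \<alpha> ((l @ 0 # r)[length l := v]))"
      using assms unfolding alt_forms_def by blast
    then show ?thesis by simp
  next
    case False
    then have "(\<lambda>v. \<alpha> (l @ v # r)) = (\<lambda>v. 0)" using alt_forms_degree[OF assms] by auto
    then show ?thesis by (simp add: linear_iff)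
  qed
qed

text \<open>Polarization: expand the vanishing value with \<open>a + b\<close> in both neighbouring
  places.\<close>

lemma alt_forms_skew:
  assumes "\<alpha> \<in> alt_forms p"
  shows "skew \<alpha>"
  unfolding skew_def
proof (intro allI)
  fix l a b r
  note ml = alt_forms_multilinear[OF assms, unfolded multilinear_def, rule_format]
  have add1: "\<alpha> (l @ (x + y) # v # r) = \<alpha> (l @ x # v # r) + \<alpha> (l @ y # v # r)" for x y v
    by (rule linear_add[OF ml])
  have add2: "\<alpha> (l @ v # (x + y) # r) = \<alpha> (l @ v # x # r) + \<alpha> (l @ v # y # r)" for x y v
    using linear_add[OF ml[of "l @ [v]" r]] by simp
  have 0: "\<alpha> (l @ x # x # r) = 0" for x
  proof -
    have "\<not> distinct (l @ x # x # r)" by simp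
    then show ?thesis using assms unfolding alt_forms_def by blast
  qed
  show "\<alpha> (l @ a # b # r) = - \<alpha> (l @ b # a # r)"
    using 0[of "a + b"] unfolding add1 add2 by (simp add: 0)
qed

section \<open>Skew-symmetric forms summed over lists of basis vectors\<close>

lemma sum_basis_lists_0: "(\<Sum>bs\<in>basis_lists 0. f (bs :: 'b::euclidean_space list)) = f []"
proof -
  have "basis_lists 0 = {[] :: 'b::euclidean_space list}" unfolding basis_lists_def by auto
  then show ?thesis by simp
qed

lemma sum_basis_lists_Suc:
  "(\<Sum>bs\<in>basis_lists (Suc p). f bs) = (\<Sum>b\<in>Basis. \<Sum>bs\<in>basis_lists p. f (b # bs))"
proof -
  have "(\<Sum>bs\<in>basis_lists (Suc p). f bs) = (\<Sum>(b, bs)\<in>Basis \<times> basis_lists p. f (b # bs))"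
    by (rule sum.reindex_bij_witness[of _ "\<lambda>(b, bs). b # bs" "\<lambda>bs. (hd bs, tl bs)"])
      (auto simp: basis_lists_def length_Suc_conv)
  then show ?thesis by (simp add: sum.cartesian_product)
qed

lemma length_basis_lists: "bs \<in> basis_lists p \<Longrightarrow> length bs = p"
  unfolding basis_lists_def by simp

text \<open>Putting the deleted entry in front costs exactly the sign of its deletion, so all
  \<open>length vs\<close> terms equal \<open>\<alpha> vs\<close>.\<close>

lemma del_sum_skew:
  fixes \<alpha> :: "'a form"
  assumes "skew \<alpha>"
  shows "del_sum vs (\<lambda>z zs. \<alpha> (z # zs)) = length vs * \<alpha> vs"
  using assms
proof (induction vs arbitrary: \<alpha>)
  case (Cons v vs)
  have "del_sum vs (\<lambda>z zs. \<alpha> (z # v # zs)) = del_sum vs (\<lambda>z zs. - \<alpha> (v # z # zs))"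
    by (rule del_sum_cong) (rule skew_swap_hd[OF Cons.prems])
  then show ?case
    using Cons.IH[OF skew_Cons[OF Cons.prems, of v]] by (simp add: del_sum_minus algebra_simps)
qed simp

text \<open>The third argument of \<open>k\<close> is the whole list. Moving the deleted entry to
  its head absorbs the sign of the deletion, so each of the \<open>Suc q\<close> positions
  contributes the same sum.\<close>

lemma sum_basis_lists_del_sum:
  fixes k :: "'a::euclidean_space \<Rightarrow> 'a list \<Rightarrow> 'a list \<Rightarrow> real"
  assumes "\<And>z zs. skew (k z zs)"
  shows "(\<Sum>cs\<in>basis_lists (Suc q). del_sum cs (\<lambda>z zs. k z zs cs))
    = Suc q * (\<Sum>c\<in>Basis. \<Sum>cs\<in>basis_lists q. k c cs (c # cs))"
  using assms
proof (induction q arbitrary: k)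
  case 0
  then show ?case by (simp add: sum_basis_lists_Suc sum_basis_lists_0)
next
  case (Suc q)
  let ?S = "\<Sum>c\<in>Basis. \<Sum>cs\<in>basis_lists (Suc q). k c cs (c # cs)"
  have "(\<Sum>cs\<in>basis_lists (Suc q). del_sum cs (\<lambda>z zs. k z (c # zs) (c # cs)))
      = Suc q * (\<Sum>z\<in>Basis. \<Sum>cs\<in>basis_lists q. - k z (c # cs) (z # c # cs))" for c
    unfolding Suc.IH[of "\<lambda>z zs cs. k z (c # zs) (c # cs)", OF skew_Cons[OF Suc.prems]]
    by (intro arg_cong2[where f="(*)"] sum.cong refl) (rule skew_swap_hd[OF Suc.prems])
  then have "(\<Sum>c\<in>Basis. \<Sum>cs\<in>basis_lists (Suc q). del_sum cs (\<lambda>z zs. k z (c # zs) (c # cs)))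
      = Suc q * (\<Sum>c\<in>Basis. \<Sum>z\<in>Basis. \<Sum>cs\<in>basis_lists q. - k z (c # cs) (z # c # cs))"
    by (simp add: sum_distrib_left)
  also have "\<dots> = - (Suc q * ?S)"
    unfolding sum_basis_lists_Suc by (subst sum.swap[of _ Basis Basis]) (simp add: sum_negf)
  finally have "(\<Sum>c\<in>Basis. \<Sum>cs\<in>basis_lists (Suc q). del_sum cs (\<lambda>z zs. k z (c # zs) (c # cs)))
      = - (Suc q * ?S)" .
  then show ?case
    by (subst sum_basis_lists_Suc) (simp add: sum_subtractf algebra_simps)
qed

text \<open>Reordering \<open>bs\<close> as \<open>u @ v\<close> inside \<open>\<alpha>\<close>
  absorbs the sign of the shuffle, so all shuffles contribute equally. The induction is Pascal's
  rule: the first entry goes to \<open>u\<close> or to \<open>v\<close>.\<close>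

lemma sum_basis_lists_shuffle_sum:
  fixes \<alpha> :: "'a::euclidean_space form"
  assumes "skew \<alpha>"
  shows "(\<Sum>bs\<in>basis_lists k. shuffle_sum bs (\<lambda>u v. if length u = a then \<Phi> u v else 0) * \<alpha> bs)
    = (k choose a) * (\<Sum>u\<in>basis_lists a. \<Sum>v\<in>basis_lists (k - a). \<Phi> u v * \<alpha> (u @ v))"
  using assms
proof (induction k arbitrary: a \<Phi> \<alpha>)
  case 0
  then show ?case by (cases a) (simp_all add: sum_basis_lists_0)
next
  case (Suc k)
  note sk = skew_Cons[OF Suc.prems]
  show ?case
  proof (cases a)
    case 0
    then show ?thesis
      by (simp add: shuffle_sum_Nil_left[of _ "\<Phi> []"] sum_basis_lists_0 cong: if_cong)
  next
    case (Suc a')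
    let ?S = "\<Sum>u\<in>basis_lists a. \<Sum>v\<in>basis_lists (Suc k - a). \<Phi> u v * \<alpha> (u @ v)"
    have "(\<Sum>bs\<in>basis_lists k.
          shuffle_sum bs (\<lambda>u v. if length (b # u) = a then \<Phi> (b # u) v else 0) * \<alpha> (b # bs))
       = (k choose a') * (\<Sum>u\<in>basis_lists a'. \<Sum>v\<in>basis_lists (k - a'). \<Phi> (b # u) v * \<alpha> (b # u @ v))" for b
      using Suc.IH[OF sk, of a' "\<lambda>u. \<Phi> (b # u)"] Suc by simp
    then have 1: "(\<Sum>b\<in>Basis. \<Sum>bs\<in>basis_lists k.
          shuffle_sum bs (\<lambda>u v. if length (b # u) = a then \<Phi> (b # u) v else 0) * \<alpha> (b # bs))
       = (k choose a') * ?S"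
      by (simp add: Suc sum_basis_lists_Suc sum_distrib_left)
    have "(\<Sum>bs\<in>basis_lists k.
          shuffle_sum bs (\<lambda>u v. (- 1) ^ length u * (if length u = a then \<Phi> u (b # v) else 0)) * \<alpha> (b # bs))
       = (k choose a) * (\<Sum>u\<in>basis_lists a. \<Sum>v\<in>basis_lists (k - a). \<Phi> u (b # v) * \<alpha> (u @ b # v))" for b
    proof -
      have "(\<lambda>u v. (- 1) ^ length u * (if length u = a then \<Phi> u (b # v) else 0))
          = (\<lambda>u v. if length u = a then (- 1) ^ length u * \<Phi> u (b # v) else 0)"
        by (intro ext) simp
      then show ?thesis
        using Suc.IH[OF sk, of a "\<lambda>u v. (- 1) ^ length u * \<Phi> u (b # v)" b]
        by (simp add: skew_move_to_hd[OF Suc.prems, of _ b] mult_ac)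
    qed
    then have "(\<Sum>b\<in>Basis. \<Sum>bs\<in>basis_lists k.
          shuffle_sum bs (\<lambda>u v. (- 1) ^ length u * (if length u = a then \<Phi> u (b # v) else 0)) * \<alpha> (b # bs))
       = (k choose a) * (\<Sum>u\<in>basis_lists a. \<Sum>b\<in>Basis. \<Sum>v\<in>basis_lists (k - a). \<Phi> u (b # v) * \<alpha> (u @ b # v))"
      by (simp add: sum.swap[of _ Basis "basis_lists a"] flip: sum_distrib_left)
    also have "\<dots> = (k choose a) * ?S"
    \<comment> \<open>For \<open>a > k\<close> the truncated \<open>Suc k - a\<close> is not
      \<open>Suc (k - a)\<close>, but then \<open>k choose a\<close> is 0.\<close>
    proof (cases "a \<le> k")
      case True
      then show ?thesis by (simp add: Suc_diff_le sum_basis_lists_Suc)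
    qed (simp add: binomial_eq_0)
    finally have 2: "(\<Sum>b\<in>Basis. \<Sum>bs\<in>basis_lists k.
          shuffle_sum bs (\<lambda>u v. (- 1) ^ length u * (if length u = a then \<Phi> u (b # v) else 0)) * \<alpha> (b # bs))
       = (k choose a) * ?S" .
    show ?thesis
      unfolding sum_basis_lists_Suc[of _ k] shuffle_sum.simps distrib_right sum.distrib 1 2
      by (simp add: Suc distrib_right)
  qed
qed

text \<open>Euler's identity: a splitting \<open>(u, v)\<close> arises once for each entry of
  \<open>u\<close> that can be taken out first, and by skew-symmetry always with the same
  sign.\<close>

lemma shuffle_sum_euler:
  fixes \<Phi> :: "'a list \<Rightarrow> 'a list \<Rightarrow> real"
  assumes "\<And>v. skew (\<lambda>u. \<Phi> u v)"
  shows "del_sum ys (\<lambda>y zs. shuffle_sum zs (\<lambda>u v. \<Phi> (y # u) v))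
    = shuffle_sum ys (\<lambda>u v. length u * \<Phi> u v)"
  using assms
proof (induction ys arbitrary: \<Phi>)
  case (Cons y ys)
  have 1: "del_sum ys (\<lambda>z zs. shuffle_sum zs (\<lambda>u v. \<Phi> (z # y # u) v))
      = - shuffle_sum ys (\<lambda>u v. length u * \<Phi> (y # u) v)"
    unfolding Cons.IH[OF skew_Cons[OF Cons.prems], symmetric] del_sum_minus[symmetric]
      shuffle_sum_minus[symmetric]
    by (intro del_sum_cong shuffle_sum_cong) (rule skew_swap_hd[OF Cons.prems])
  have swap: "\<Phi> (l @ a # b # r) v = - \<Phi> (l @ b # a # r) v" for l a b r v
    using Cons.prems unfolding skew_def by blast
  have sk: "skew (\<lambda>u. (- 1) ^ length u * \<Phi> u (y # v))" for v
    unfolding skew_def by (intro allI, subst swap) simp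
  have 2: "del_sum ys (\<lambda>z zs. shuffle_sum zs (\<lambda>u v. (- 1) ^ length u * \<Phi> (z # u) (y # v)))
      = - shuffle_sum ys (\<lambda>u v. (- 1) ^ length u * (length u * \<Phi> u (y # v)))"
    using Cons.IH[of "\<lambda>u v. (- 1) ^ length u * \<Phi> u (y # v)", OF sk] by (simp add: shuffle_sum_minus del_sum_minus mult_ac)
  show ?case
    by (simp add: 1 2 del_sum_add shuffle_sum_add distrib_right)
qed simp

section \<open>Gram determinants and the Hodge star\<close>

primrec gram :: "'a::euclidean_space list \<Rightarrow> 'a list \<Rightarrow> real" where
  "gram [] vs = (if vs = [] then 1 else 0)"
| "gram (u # us) vs = del_sum vs (\<lambda>z zs. (u \<bullet> z) * gram us zs)"

lemma gram_degree: "length us \<noteq> length vs \<Longrightarrow> gram us vs = 0"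
  by (induction us arbitrary: vs) (auto intro!: del_sum_0)

text \<open>Laplace expansion along the first column instead of the first row: a row and a column
  can be deleted in either order.\<close>

lemma gram_Cons_right: "gram us (v # vs) = del_sum us (\<lambda>z zs. (z \<bullet> v) * gram zs vs)"
proof (induction us arbitrary: vs)
  case (Cons u us)
  have "del_sum vs (\<lambda>z zs. (u \<bullet> z) * gram us (v # zs))
      = del_sum vs (\<lambda>z zs. (u \<bullet> z) * del_sum us (\<lambda>w ws. (w \<bullet> v) * gram ws zs))"
    by (simp add: Cons.IH)
  also have "\<dots> = del_sum vs (\<lambda>z zs. del_sum us (\<lambda>w ws. (w \<bullet> v) * ((u \<bullet> z) * gram ws zs)))"
    by (simp add: mult_ac flip: del_sum_mult)
  also have "\<dots> = del_sum us (\<lambda>w ws. (w \<bullet> v) * gram (u # ws) vs)"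
    by (subst del_sum_swap) (simp add: del_sum_mult)
  finally show ?case by simp
qed simp

lemma gram_sym: "gram us vs = gram vs us"
proof (induction us arbitrary: vs)
  case Nil
  then show ?case by (cases vs) auto
next
  case (Cons u us)
  have "gram (u # us) vs = del_sum vs (\<lambda>z zs. (z \<bullet> u) * gram zs us)"
    unfolding gram.simps by (rule del_sum_cong) (simp add: Cons.IH inner_commute)
  then show ?case by (simp add: gram_Cons_right)
qed

text \<open>In the expansion along the row \<open>u\<close>, the terms that delete \<open>a\<close>
  or \<open>b\<close> change places with opposite signs; in all others both columns remain and the
  induction hypothesis applies.\<close>

lemma skew_gram: "skew (gram us)"
proof (induction us)
  case (Cons u us)
  have swap: "gram us (l @ a # b # r) = - gram us (l @ b # a # r)" for l a b r
    using Cons.IH unfolding skew_def by blast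
  have 1: "del_sum l (\<lambda>z zs. (u \<bullet> z) * gram us (zs @ a # b # r))
      = - del_sum l (\<lambda>z zs. (u \<bullet> z) * gram us (zs @ b # a # r))" for l a b r
    unfolding del_sum_minus[symmetric] by (rule del_sum_cong) (subst swap, simp)
  have 2: "del_sum r (\<lambda>z zs. (u \<bullet> z) * gram us (l @ a # b # zs))
      = - del_sum r (\<lambda>z zs. (u \<bullet> z) * gram us (l @ b # a # zs))" for l a b r
    unfolding del_sum_minus[symmetric] by (rule del_sum_cong) (subst swap, simp)
  show ?case
    unfolding skew_def
  proof (intro allI)
    fix l a b r
    show "gram (u # us) (l @ a # b # r) = - gram (u # us) (l @ b # a # r)"
      unfolding gram.simps del_sum_append del_sum.simps 1[of l a b r] 2[of r l a b]
      by (simp add: algebra_simps)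
  qed
qed (simp add: skew_def)

lemma multilinear_gram: "multilinear (gram us)"
proof (induction us)
  case (Cons u us)
  have lin: "linear (\<lambda>v. (u \<bullet> z) * gram us (l @ v # r))" for z l r
    using linear_compose_scale_right[of "\<lambda>v. gram us (l @ v # r)" "u \<bullet> z"] Cons.IH
    unfolding multilinear_def by simp
  show ?case
    unfolding multilinear_def
  proof (intro allI)
    fix l r
    have 1: "linear (\<lambda>v. del_sum l (\<lambda>z zs. (u \<bullet> z) * gram us (zs @ v # r)))"
      by (rule del_sum_linear) (rule lin)
    have 2: "linear (\<lambda>v. del_sum r (\<lambda>z zs. (u \<bullet> z) * gram us (l @ v # zs)))"
      by (rule del_sum_linear) (rule lin)
    show "linear (\<lambda>v. gram (u # us) (l @ v # r))"
      using 1 2 unfolding gram.simps del_sum_append del_sum.simps linear_iff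
      by (simp add: inner_add_right algebra_simps)
  qed
qed (simp add: multilinear_def linear_iff)

text \<open>Summing a row \<open>b\<close> of the determinant against \<open>\<alpha>\<close> puts
  an entry of \<open>vs\<close> in place of \<open>b\<close>. After all rows, each of the
  \<open>fact m\<close> terms is \<open>\<alpha> vs\<close> by skew-symmetry. Thus pairing with
  \<open>gram\<close> extends from basis vectors to arbitrary ones.\<close>

lemma sum_gram_mult:
  fixes \<alpha> :: "'a::euclidean_space form"
  assumes "skew \<alpha>" "multilinear \<alpha>"
  shows "(\<Sum>bs\<in>basis_lists m. gram bs vs * \<alpha> bs) = (if length vs = m then fact m * \<alpha> vs else 0)"
  using assms
proof (induction m arbitrary: \<alpha> vs)
  case 0
  then show ?case by (simp add: sum_basis_lists_0)
next
  case (Suc m)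
  have "(\<Sum>bs\<in>basis_lists (Suc m). gram bs vs * \<alpha> bs)
      = (\<Sum>bs\<in>basis_lists m. \<Sum>b\<in>Basis. del_sum vs (\<lambda>z zs. gram bs zs * ((b \<bullet> z) * \<alpha> (b # bs))))"
    unfolding sum_basis_lists_Suc
    by (subst sum.swap) (simp add: mult_ac flip: del_sum_mult)
  also have "\<dots> = del_sum vs (\<lambda>z zs. \<Sum>bs\<in>basis_lists m. gram bs zs * \<alpha> (z # bs))"
    by (simp add: multilinear_expand_Basis[OF Suc.prems(2)] flip: del_sum_sum sum_distrib_left)
  also have "\<dots> = del_sum vs (\<lambda>z zs. (if length vs = Suc m then fact m else 0) * \<alpha> (z # zs))"
    by (rule del_sum_cong)
      (use Suc.IH[OF skew_Cons[OF Suc.prems(1)] multilinear_Cons[OF Suc.prems(2)]] in auto)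
  also have "\<dots> = (if length vs = Suc m then fact (Suc m) * \<alpha> vs else 0)"
    by (simp add: del_sum_mult del_sum_skew[OF Suc.prems(1)])
  finally show ?case .
qed

text \<open>In the expansion along the row \<open>b\<close>, the column \<open>b\<close> gives
  \<open>gram us vs\<close> once for each basis vector. Every column \<open>z\<close> of
  \<open>vs\<close> replaces the other \<open>b\<close> by \<open>z\<close>, which restores
  \<open>gram us vs\<close> with a minus sign.\<close>

lemma sum_Basis_gram_Cons:
  fixes us :: "'a::euclidean_space list"
  shows "(\<Sum>b\<in>Basis. gram (b # us) (b # vs)) = (real DIM('a) - length vs) * gram us vs"
proof -
  have "(\<Sum>b\<in>Basis. gram (b # us) (b # vs))
      = DIM('a) * gram us vs - del_sum vs (\<lambda>z zs. \<Sum>b\<in>Basis. (b \<bullet> z) * gram us (b # zs))"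
    by (simp add: sum_subtractf del_sum_sum)
  then show ?thesis
    by (simp add: multilinear_expand_Basis[OF multilinear_gram] del_sum_skew[OF skew_gram] left_diff_distrib)
qed

lemma sum_basis_lists_gram_append:
  fixes us :: "'a::euclidean_space list"
  assumes "m + length vs \<le> DIM('a)"
  shows "(\<Sum>bs\<in>basis_lists m. gram (bs @ us) (bs @ vs))
    = fact (DIM('a) - length vs) / fact (DIM('a) - length vs - m) * gram us vs"
  using assms
proof (induction m)
  case 0
  then show ?case by (simp add: sum_basis_lists_0)
next
  case (Suc m)
  let ?N = "DIM('a) - length vs - m"
  have N: "?N = Suc (DIM('a) - length vs - Suc m)" using Suc.prems by simp
  have "(\<Sum>bs\<in>basis_lists (Suc m). gram (bs @ us) (bs @ vs))
      = (\<Sum>bs\<in>basis_lists m. real ?N * gram (bs @ us) (bs @ vs))"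
    unfolding sum_basis_lists_Suc append_Cons using Suc.prems
    by (subst sum.swap, intro sum.cong refl, subst sum_Basis_gram_Cons)
      (simp add: length_basis_lists of_nat_diff)
  also have "\<dots> = fact (DIM('a) - length vs) * (?N / fact ?N) * gram us vs"
    using Suc by (simp flip: sum_distrib_left)
  also have "?N / fact ?N = 1 / fact (DIM('a) - length vs - Suc m)"
    unfolding N by (simp add: divide_simps)
  finally show ?case by simp
qed

section \<open>Forms of top degree and the unit volume form\<close>

lemma skew_perm:
  assumes "skew \<alpha>" "skew \<beta>" "mset bs = mset cs"
  shows "\<alpha> bs * \<beta> cs = \<alpha> cs * \<beta> bs"
  using assms
proof (induction bs arbitrary: cs \<alpha> \<beta>)
  case (Cons b bs)
  have "b \<in> set cs" using Cons.prems(3) by (metis list.set_intros(1) mset_eq_setD)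
  then obtain l r where cs: "cs = l @ b # r" by (meson split_list)
  then have "mset bs = mset (l @ r)" using Cons.prems(3) by simp
  from Cons.IH[OF skew_Cons[OF Cons.prems(1)] skew_Cons[OF Cons.prems(2)] this, of b b]
  show ?case
    \<comment> \<open>Both forms pick up the same power of -1, so the products agree without any
      sign of a permutation being named.\<close>
    unfolding cs skew_move_to_hd[OF Cons.prems(1)] skew_move_to_hd[OF Cons.prems(2)] by simp
qed simp

text \<open>Forms of top degree are a one-dimensional space, expressed by cross-multiplication so
  that nothing is divided. On basis lists either an entry repeats or both lists are orderings of the
  whole basis; \<open>sum_gram_mult\<close> extends this to arbitrary \<open>us\<close>.\<close>

lemma top_form_proportional:
  fixes \<alpha> \<beta> :: "'a::euclidean_space form"
  assumes "skew \<alpha>" "multilinear \<alpha>" "skew \<beta>" "multilinear \<beta>"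
    and bs: "bs \<in> basis_lists DIM('a)" and len: "length us = DIM('a)"
  shows "\<alpha> us * \<beta> bs = \<beta> us * \<alpha> bs"
proof -
  have *: "\<alpha> cs * \<beta> bs = \<beta> cs * \<alpha> bs" if cs: "cs \<in> basis_lists DIM('a)" for cs
  proof (cases "distinct bs \<and> distinct cs")
    case True
    have "set zs = Basis" if "zs \<in> basis_lists DIM('a)" "distinct zs" for zs :: "'a list"
      using that by (intro card_subset_eq) (auto simp: basis_lists_def distinct_card)
    then have "set cs = Basis" "set bs = Basis" using bs cs True by blast+
    then have "mset bs = mset cs" using True by (metis set_eq_iff_mset_eq_distinct)
    then show ?thesis using skew_perm[OF assms(1,3), of bs cs] by (simp add: mult.commute)
  next
    case False
    then show ?thesis
      using skew_not_distinct[OF assms(1)] skew_not_distinct[OF assms(3)] by auto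
  qed
  have "fact DIM('a) * (\<alpha> us * \<beta> bs) = (\<Sum>cs\<in>basis_lists DIM('a). gram cs us * (\<alpha> cs * \<beta> bs))"
    using sum_gram_mult[OF assms(1,2), where m = "DIM('a)" and vs = us] len
    by (simp add: mult.assoc[symmetric] flip: sum_distrib_right)
  also have "\<dots> = (\<Sum>cs\<in>basis_lists DIM('a). gram cs us * (\<beta> cs * \<alpha> bs))"
    by (rule sum.cong) (use * in auto)
  also have "\<dots> = fact DIM('a) * (\<beta> us * \<alpha> bs)"
    using sum_gram_mult[OF assms(3,4), where m = "DIM('a)" and vs = us] len
    by (simp add: mult.assoc[symmetric] flip: sum_distrib_right)
  finally show ?thesis by simp
qed

lemma sum_unit_volume_form_sq:
  fixes vol :: "'a::euclidean_space form"
  assumes "unit_volume_form vol"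
  shows "(\<Sum>bs\<in>basis_lists DIM('a). vol bs * vol bs) = fact DIM('a)"
proof -
  let ?D = "{xs :: 'a list. length xs = DIM('a) \<and> distinct xs \<and> set xs \<subseteq> Basis}"
  have sk: "skew vol" using assms alt_forms_skew unfolding unit_volume_form_def by blast
  have unit: "vol bs * vol bs = 1" if "bs \<in> ?D" for bs
  proof -
    have "\<forall>i<DIM('a). \<forall>j<DIM('a). bs ! i \<bullet> bs ! j = (if i = j then 1 else 0)"
    proof (intro allI impI)
      fix i j assume ij: "i < DIM('a)" "j < DIM('a)"
      then have "bs ! i \<in> Basis" "bs ! j \<in> Basis" using that nth_mem by fastforce+
      then show "bs ! i \<bullet> bs ! j = (if i = j then 1 else 0)"
        using that ij by (simp add: inner_Basis nth_eq_iff_index_eq)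
    qed
    then have "\<bar>vol bs\<bar> = 1" using assms that unfolding unit_volume_form_def by blast
    then show ?thesis by (metis abs_mult_self_eq mult_1)
  qed
  have "distinct bs" if "vol bs \<noteq> 0" for bs
    using skew_not_distinct[OF sk] that by blast
  then have "(\<Sum>bs\<in>basis_lists DIM('a). vol bs * vol bs) = (\<Sum>bs\<in>?D. vol bs * vol bs)"
    by (intro sum.mono_neutral_right) (auto simp: basis_lists_def finite_lists_length_eq)
  also have "\<dots> = card ?D" using unit by simp
  also have "card ?D = fact DIM('a)"
    by (subst card_lists_distinct_length_eq) (simp_all add: fact_prod)
  finally show ?thesis by simp
qed

text \<open>As functions of the first list, \<open>vol\<close> and \<open>gram _ vs\<close> are
  proportional. Expanding \<open>vol vs\<close> over basis lists and exchanging the two leaves the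
  sum of the squares of \<open>vol\<close>, which is \<open>fact n\<close>. The product of two
  values is therefore independent of the orientation.\<close>

lemma unit_volume_form_mult:
  fixes vol :: "'a::euclidean_space form"
  assumes "unit_volume_form vol" "length us = DIM('a)" "length vs = DIM('a)"
  shows "vol us * vol vs = gram us vs"
proof -
  let ?n = "DIM('a)"
  have "vol \<in> alt_forms ?n" using assms(1) unfolding unit_volume_form_def by blast
  note vol = alt_forms_skew[OF this] alt_forms_multilinear[OF this]
  have g: "skew (\<lambda>xs. gram xs vs)" "multilinear (\<lambda>xs. gram xs vs)"
    using skew_gram[of vs] multilinear_gram[of vs] by (simp_all add: gram_sym[of _ vs] eta_contract_eq)
  have "fact ?n * (vol us * vol vs) = vol us * (\<Sum>bs\<in>basis_lists ?n. gram bs vs * vol bs)"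
    using sum_gram_mult[OF vol, where m = ?n and vs = vs] assms(3) by simp
  also have "\<dots> = (\<Sum>bs\<in>basis_lists ?n. vol us * gram bs vs * vol bs)"
    by (simp add: sum_distrib_left mult.assoc)
  also have "\<dots> = (\<Sum>bs\<in>basis_lists ?n. gram us vs * (vol bs * vol bs))"
    using top_form_proportional[OF vol g _ assms(2)] by (intro sum.cong) auto
  also have "\<dots> = fact ?n * gram us vs"
    by (simp add: sum_unit_volume_form_sq[OF assms(1)] flip: sum_distrib_left)
  finally show ?thesis by simp
qed

section \<open>Powers of the metric and the Hodge star of their products\<close>

lemma metric_form_case:
  "metric_form u v = (case u of [x] \<Rightarrow> (case v of [y] \<Rightarrow> x \<bullet> y | _ \<Rightarrow> 0) | _ \<Rightarrow> 0)"
  by (auto simp: metric_form_apply split: list.split) (auto simp: metric_form_def tensor_def covector_def)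

lemma dmult_metric_form:
  "dmult metric_form \<eta> xs ys = del_sum xs (\<lambda>x us. del_sum ys (\<lambda>y vs. (x \<bullet> y) * \<eta> us vs))"
proof -
  have "shuffle_sum ys (\<lambda>v v'. metric_form u v * \<eta> u' v')
      = (case u of [x] \<Rightarrow> del_sum ys (\<lambda>y vs. (x \<bullet> y) * \<eta> u' vs) | _ \<Rightarrow> 0)" for u u'
  proof -
    have "shuffle_sum ys (\<lambda>v v'. (case v of [y] \<Rightarrow> x \<bullet> y | _ \<Rightarrow> 0) * \<eta> u' v')
      = shuffle_sum ys (\<lambda>v v'. case v of [y] \<Rightarrow> (x \<bullet> y) * \<eta> u' v' | _ \<Rightarrow> 0)" for x
      by (rule shuffle_sum_cong) (simp split: list.split)
    then show ?thesis
      unfolding metric_form_case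
      by (auto simp: shuffle_sum_0 shuffle_sum_singleton split: list.split)
  qed
  then show ?thesis
    by (simp add: dmult_shuffle_sum shuffle_sum_singleton[of xs "\<lambda>x us. del_sum ys (\<lambda>y vs. (x \<bullet> y) * \<eta> us vs)"])
qed

text \<open>Multiplying by \<open>g\<close> chooses a row \<open>x\<close> and expands along it.
  Each of the \<open>length xs\<close> choices gives the same determinant, which builds up the
  factorial.\<close>

lemma dpow_metric_form:
  "dpow metric_form m xs ys = (if length xs = m then fact m * gram xs ys else 0)"
proof (induction m arbitrary: xs ys)
  case 0
  then show ?case by (auto simp: dunit_def)
next
  case (Suc m)
  let ?c = "if length xs = Suc m then fact m else 0 :: real"
  have "dpow metric_form (Suc m) xs ys
      = del_sum xs (\<lambda>x us. ?c * del_sum ys (\<lambda>y vs. (x \<bullet> y) * gram us vs))"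
    unfolding dpow.simps dmult_metric_form del_sum_mult[symmetric]
    by (intro del_sum_cong) (simp add: Suc.IH)
  also have "\<dots> = ?c * del_sum xs (\<lambda>x us. gram (x # us) ys)"
    by (simp add: del_sum_mult)
  also have "del_sum xs (\<lambda>x us. gram (x # us) ys) = length xs * gram xs ys"
    unfolding gram_sym[of _ ys] by (rule del_sum_skew[OF skew_gram])
  finally show ?case by simp
qed

text \<open>Both shuffle sums reduce to one splitting times a binomial coefficient. Pairing
  \<open>gram u v\<close> with \<open>vol\<close> puts \<open>u\<close> in place of
  \<open>v\<close>; then the two volume forms combine to a Gram determinant, and the
  \<open>a\<close> common vectors \<open>u\<close> are contracted away.\<close>

lemma dhodge_dmult_gram:
  fixes vol :: "'a::euclidean_space form"
  assumes vol: "unit_volume_form vol"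
    and len: "length xs + a + p = DIM('a)" "length ys + a + p = DIM('a)"
  shows "dhodge vol (dmult (\<lambda>u v. if length u = a then gram u v else 0) \<omega>) xs ys
    = (\<Sum>bs\<in>basis_lists p. \<Sum>cs\<in>basis_lists p. \<omega> bs cs * gram (bs @ xs) (cs @ ys)) / (fact p * fact p)"
proof -
  let ?k = "a + p"
  have "vol \<in> alt_forms DIM('a)" using vol unfolding unit_volume_form_def by blast
  note sk = alt_forms_skew[OF this] and ml = alt_forms_multilinear[OF this]
  define \<Psi> where "\<Psi> cs u u' = shuffle_sum cs (\<lambda>v v'. if length v = a then gram u v * \<omega> u' v' else 0)"
    for cs u u'
  have dm: "dmult (\<lambda>u v. if length u = a then gram u v else 0) \<omega> bs cs
      = shuffle_sum bs (\<lambda>u u'. if length u = a then \<Psi> cs u u' else 0)" for bs cs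
    unfolding dmult_shuffle_sum \<Psi>_def
    by (intro shuffle_sum_cong) (auto intro!: shuffle_sum_cong shuffle_sum_0 simp: gram_degree)
  have inner: "(\<Sum>cs\<in>basis_lists ?k. \<Psi> cs u u' * vol (cs @ ys))
      = (?k choose a) * fact a * (\<Sum>v'\<in>basis_lists p. \<omega> u' v' * vol (u @ v' @ ys))"
    if "u \<in> basis_lists a" for u u'
  proof -
    have "(\<Sum>cs\<in>basis_lists ?k. \<Psi> cs u u' * vol (cs @ ys))
        = (?k choose a) * (\<Sum>v\<in>basis_lists a. \<Sum>v'\<in>basis_lists p. gram u v * \<omega> u' v' * vol (v @ v' @ ys))"
      unfolding \<Psi>_def by (subst sum_basis_lists_shuffle_sum[OF skew_append[OF sk]]) simp
    also have "(\<Sum>v\<in>basis_lists a. \<Sum>v'\<in>basis_lists p. gram u v * \<omega> u' v' * vol (v @ v' @ ys))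
        = (\<Sum>v'\<in>basis_lists p. \<omega> u' v' * (\<Sum>v\<in>basis_lists a. gram v u * vol (v @ v' @ ys)))"
      by (subst sum.swap) (simp add: sum_distrib_left gram_sym[of u] mult_ac)
    also have "\<dots> = fact a * (\<Sum>v'\<in>basis_lists p. \<omega> u' v' * vol (u @ v' @ ys))"
      using length_basis_lists[OF that]
      by (simp add: sum_gram_mult[OF skew_append[OF sk] multilinear_append[OF ml]] sum_distrib_left mult_ac)
    finally show ?thesis by simp
  qed
  have gr: "(\<Sum>u\<in>basis_lists a. vol (u @ u' @ xs) * vol (u @ v' @ ys)) = fact a * gram (u' @ xs) (v' @ ys)"
    if "u' \<in> basis_lists p" "v' \<in> basis_lists p" for u' v'
  proof -
    have "(\<Sum>u\<in>basis_lists a. vol (u @ u' @ xs) * vol (u @ v' @ ys))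
        = (\<Sum>u\<in>basis_lists a. gram (u @ u' @ xs) (u @ v' @ ys))"
      using len length_basis_lists[OF that(1)] length_basis_lists[OF that(2)]
      by (intro sum.cong refl unit_volume_form_mult[OF vol]) (auto dest: length_basis_lists)
    also have "\<dots> = fact a * gram (u' @ xs) (v' @ ys)"
    proof -
      \<comment> \<open>All \<open>a\<close> free dimensions are used up, so the falling factorial
        is \<open>fact a / fact 0\<close>.\<close>
      have "a + length (v' @ ys) \<le> DIM('a)" "DIM('a) - length (v' @ ys) = a"
        using len(2) length_basis_lists[OF that(2)] by simp_all
      then show ?thesis using sum_basis_lists_gram_append[of a "v' @ ys" "u' @ xs"] by simp
    qed
    finally show ?thesis .
  qed
  let ?C = "real (?k choose a)"
  have "(\<Sum>bs\<in>basis_lists ?k. \<Sum>cs\<in>basis_lists ?k.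
        shuffle_sum bs (\<lambda>u u'. if length u = a then \<Psi> cs u u' else 0) * vol (bs @ xs) * vol (cs @ ys))
      = (\<Sum>cs\<in>basis_lists ?k. (\<Sum>bs\<in>basis_lists ?k.
        shuffle_sum bs (\<lambda>u u'. if length u = a then \<Psi> cs u u' else 0) * vol (bs @ xs)) * vol (cs @ ys))"
    by (subst sum.swap) (simp add: sum_distrib_right)
  also have "\<dots> = (\<Sum>cs\<in>basis_lists ?k. ?C * (\<Sum>u\<in>basis_lists a. \<Sum>u'\<in>basis_lists p.
        \<Psi> cs u u' * vol (u @ u' @ xs)) * vol (cs @ ys))"
    by (subst sum_basis_lists_shuffle_sum[OF skew_append[OF sk]]) simp
  also have "\<dots> = ?C * (\<Sum>u\<in>basis_lists a. \<Sum>u'\<in>basis_lists p.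
        vol (u @ u' @ xs) * (\<Sum>cs\<in>basis_lists ?k. \<Psi> cs u u' * vol (cs @ ys)))"
    unfolding sum_distrib_left sum_distrib_right
    by (subst sum.swap, rule sum.cong[OF refl], subst sum.swap) (simp add: mult_ac)
  also have "\<dots> = ?C * (\<Sum>u\<in>basis_lists a. \<Sum>u'\<in>basis_lists p.
        vol (u @ u' @ xs) * (?C * fact a * (\<Sum>v'\<in>basis_lists p. \<omega> u' v' * vol (u @ v' @ ys))))"
    by (simp add: inner)
  also have "\<dots> = ?C * ?C * fact a * (\<Sum>u'\<in>basis_lists p. \<Sum>v'\<in>basis_lists p.
        \<omega> u' v' * (\<Sum>u\<in>basis_lists a. vol (u @ u' @ xs) * vol (u @ v' @ ys)))"
    unfolding sum_distrib_left
    by (subst sum.swap, rule sum.cong[OF refl], subst sum.swap) (simp add: mult_ac)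
  also have "\<dots> = ?C * ?C * fact a * (\<Sum>u'\<in>basis_lists p. \<Sum>v'\<in>basis_lists p.
        \<omega> u' v' * (fact a * gram (u' @ xs) (v' @ ys)))"
    by (simp add: gr)
  also have "\<dots> = (?C * fact a) * (?C * fact a) * (\<Sum>u'\<in>basis_lists p. \<Sum>v'\<in>basis_lists p.
        \<omega> u' v' * gram (u' @ xs) (v' @ ys))"
    by (simp add: sum_distrib_left mult_ac)
  \<comment> \<open>The two \<open>fact ?k\<close> cancel the denominators in the Hodge star and
    leave \<open>fact p * fact p\<close>.\<close>
  also have "?C * fact a = fact ?k / fact p" by (simp add: binomial_fact)
  finally have "(\<Sum>bs\<in>basis_lists ?k. \<Sum>cs\<in>basis_lists ?k.
        dmult (\<lambda>u v. if length u = a then gram u v else 0) \<omega> bs cs * vol (bs @ xs) * vol (cs @ ys))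
      = fact ?k / fact p * (fact ?k / fact p) * (\<Sum>u'\<in>basis_lists p. \<Sum>v'\<in>basis_lists p.
        \<omega> u' v' * gram (u' @ xs) (v' @ ys))"
    unfolding dm .
  moreover have "DIM('a) - length xs = ?k" "DIM('a) - length ys = ?k" using len by simp_all
  ultimately show ?thesis by (simp add: dhodge_def)
qed

section \<open>Iterated contractions\<close>

text \<open>For \<open>p = 0\<close> the truncated \<open>p - 1\<close> is harmless: a form of
  degree 0 vanishes on nonempty lists, so the result is the zero form.\<close>

lemma alt_forms_Cons:
  assumes "\<alpha> \<in> alt_forms p"
  shows "(\<lambda>xs. \<alpha> (x # xs)) \<in> alt_forms (p - 1)"
proof (cases p)
  case 0
  then have "\<alpha> (x # xs) = 0" for xs using alt_forms_degree[OF assms] by simp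
  then show ?thesis unfolding alt_forms_def by (simp add: linear_iff)
next
  case (Suc m)
  have "linear (\<lambda>v. \<alpha> (x # xs[i := v]))" if "length xs = m" "i < m" for xs i
  proof -
    have "length (x # xs) = p \<and> Suc i < p" using that Suc by simp
    then have "linear (\<lambda>v. \<alpha> ((x # xs)[Suc i := v]))" using assms unfolding alt_forms_def by blast
    then show ?thesis by simp
  qed
  moreover have "\<alpha> (x # xs) = 0" if "length xs = m" "\<not> distinct xs" for xs
    using skew_not_distinct[OF alt_forms_skew[OF assms]] that by simp
  ultimately show ?thesis
    using alt_forms_degree[OF assms] Suc unfolding alt_forms_def by simp
qed

lemma alt_forms_sum:
  assumes "\<And>i. i \<in> I \<Longrightarrow> f i \<in> alt_forms p"
  shows "(\<lambda>xs. \<Sum>i\<in>I. f i xs) \<in> alt_forms p"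
  using assms unfolding alt_forms_def by (auto intro!: linear_compose_sum sum.neutral)

lemma double_forms_Cons:
  "\<omega> \<in> double_forms p q \<Longrightarrow> (\<lambda>xs ys. \<omega> (x # xs) ys) \<in> double_forms (p - 1) q"
  unfolding double_forms_def using alt_forms_Cons by auto

lemma double_forms_degree:
  "\<omega> \<in> double_forms p q \<Longrightarrow> \<omega> xs ys \<noteq> 0 \<Longrightarrow> length xs = p \<and> length ys = q"
  unfolding double_forms_def
  using alt_forms_degree[of "\<lambda>xs. \<omega> xs ys" p xs] alt_forms_degree[of "\<omega> xs" q ys] by auto

lemma contraction_double_forms:
  assumes "\<omega> \<in> double_forms p q"
  shows "contraction \<omega> \<in> double_forms (p - 1) (q - 1)"
proof -
  have "(\<lambda>xs. \<omega> (b # xs) (b # ys)) \<in> alt_forms (p - 1)" for b ys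
    using assms alt_forms_Cons[of "\<lambda>xs. \<omega> xs (b # ys)"] unfolding double_forms_def by auto
  moreover have "(\<lambda>ys. \<omega> (b # xs) (b # ys)) \<in> alt_forms (q - 1)" for b xs
    using assms alt_forms_Cons[of "\<omega> (b # xs)"] unfolding double_forms_def by auto
  ultimately show ?thesis
    unfolding double_forms_def contraction_def by (auto intro!: alt_forms_sum)
qed

lemma funpow_contraction_double_forms:
  "\<omega> \<in> double_forms p q \<Longrightarrow> (contraction ^^ r) \<omega> \<in> double_forms (p - r) (q - r)"
proof (induction r)
  case (Suc r)
  then show ?case using contraction_double_forms[of "(contraction ^^ r) \<omega>" "p - r" "q - r"] by simp
qed simp

lemma funpow_contraction_Suc:
  "(contraction ^^ Suc r) \<omega> us vs = (\<Sum>b\<in>Basis. (contraction ^^ r) \<omega> (b # us) (b # vs))"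
  by (simp add: contraction_def[of "(contraction ^^ r) \<omega>"])

text \<open>Without truncated subtraction the degrees also show that \<open>c^r \<omega>\<close> is
  zero once \<open>r\<close> exceeds \<open>p\<close> or \<open>q\<close>.\<close>

lemma funpow_contraction_degree:
  assumes "\<omega> \<in> double_forms p q" "(contraction ^^ r) \<omega> us vs \<noteq> 0"
  shows "length us + r = p \<and> length vs + r = q"
  using assms(2)
proof (induction r arbitrary: us vs)
  case 0
  then show ?case using double_forms_degree[OF assms(1)] by auto
next
  case (Suc r)
  then obtain b where "(contraction ^^ r) \<omega> (b # us) (b # vs) \<noteq> 0"
    unfolding funpow_contraction_Suc by (meson sum.neutral)
  then show ?case using Suc.IH by fastforce
qed

lemma funpow_contraction_sym:
  assumes "\<And>us vs. \<omega> us vs = \<omega> vs us"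
  shows "(contraction ^^ r) \<omega> us vs = (contraction ^^ r) \<omega> vs us"
proof (induction r arbitrary: us vs)
  case (Suc r)
  show ?case unfolding funpow_contraction_Suc by (intro sum.cong refl Suc.IH)
qed (simp add: assms)

text \<open>Each contraction inserts its basis vector on the other side of \<open>y\<close>, which
  costs one transposition.\<close>

lemma funpow_contraction_Cons:
  assumes "\<omega> \<in> double_forms p q"
  shows "(contraction ^^ r) (\<lambda>us vs. \<omega> (y # us) vs) us vs = (- 1) ^ r * (contraction ^^ r) \<omega> (y # us) vs"
proof (induction r arbitrary: us vs)
  case (Suc r)
  have sk: "skew (\<lambda>us. (contraction ^^ r) \<omega> us vs)" for vs
    using funpow_contraction_double_forms[OF assms, of r] alt_forms_skew unfolding double_forms_def by blast
  have swap: "(contraction ^^ r) \<omega> (y # b # us) (b # vs) = - (contraction ^^ r) \<omega> (b # y # us) (b # vs)" for b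
    by (rule skew_swap_hd[OF sk])
  show ?case
    unfolding funpow_contraction_Suc by (simp add: Suc.IH swap sum_distrib_left sum_negf)
qed simp

text \<open>The case of no extra rows. Expanding along the extra columns moves rows from
  \<open>xs\<close> into \<open>\<alpha>\<close>, and Euler's identity supplies the next factor of
  \<open>fact q\<close>, since only \<open>length u' = q\<close> counts.\<close>

lemma sum_basis_lists_gram_append_right:
  fixes \<alpha> :: "'a::euclidean_space form"
  assumes "\<alpha> \<in> alt_forms q"
  shows "(\<Sum>cs\<in>basis_lists q. \<alpha> cs * gram xs (cs @ ys))
    = fact q * shuffle_sum xs (\<lambda>u' u. \<alpha> u' * gram u ys)"
  using assms
proof (induction q arbitrary: \<alpha> xs)
  case 0
  have "shuffle_sum xs (\<lambda>u' u. \<alpha> u' * gram u ys)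
      = shuffle_sum xs (\<lambda>u' u. if u' = [] then \<alpha> [] * gram u ys else 0)"
    by (rule shuffle_sum_cong) (use alt_forms_degree[OF 0] in auto)
  then show ?case by (simp add: sum_basis_lists_0 shuffle_sum_Nil_left)
next
  case (Suc q)
  note sk = alt_forms_skew[OF Suc.prems] and ml = alt_forms_multilinear[OF Suc.prems]
  have "(\<Sum>cs\<in>basis_lists (Suc q). \<alpha> cs * gram xs (cs @ ys))
      = (\<Sum>cs\<in>basis_lists q. \<Sum>c\<in>Basis. del_sum xs (\<lambda>z zs. (c \<bullet> z) * \<alpha> (c # cs) * gram zs (cs @ ys)))"
    unfolding sum_basis_lists_Suc append_Cons gram_Cons_right
    by (subst sum.swap) (simp add: mult_ac inner_commute flip: del_sum_mult)
  also have "\<dots> = del_sum xs (\<lambda>z zs. \<Sum>cs\<in>basis_lists q. \<alpha> (z # cs) * gram zs (cs @ ys))"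
    by (simp add: multilinear_expand_Basis[OF ml] flip: del_sum_sum sum_distrib_right)
  also have "\<dots> = del_sum xs (\<lambda>z zs. fact q * shuffle_sum zs (\<lambda>u' u. \<alpha> (z # u') * gram u ys))"
    using Suc.IH[OF alt_forms_Cons[OF Suc.prems, simplified]] by simp
  also have "\<dots> = fact q * shuffle_sum xs (\<lambda>u' u. length u' * (\<alpha> u' * gram u ys))"
  proof -
    have "\<alpha> (l @ a # b # r) * t = - (\<alpha> (l @ b # a # r) * t)" for l a b r t
      using sk unfolding skew_def by (metis mult_minus_left)
    then have "skew (\<lambda>u'. \<alpha> u' * gram u ys)" for u
      unfolding skew_def by blast
    from shuffle_sum_euler[of "\<lambda>u' u. \<alpha> u' * gram u ys", OF this] show ?thesis
      by (simp add: del_sum_mult)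
  qed
  also have "shuffle_sum xs (\<lambda>u' u. length u' * (\<alpha> u' * gram u ys))
      = shuffle_sum xs (\<lambda>u' u. Suc q * (\<alpha> u' * gram u ys))"
    by (rule shuffle_sum_cong) (use alt_forms_degree[OF Suc.prems] in force)
  finally show ?case unfolding shuffle_sum_mult by simp
qed

text \<open>For \<open>p = q\<close> this is the sum left by \<open>dhodge_dmult_gram\<close>. The
  degrees are kept apart because inserting an argument into \<open>\<omega>\<close> lowers only
  \<open>p\<close>.\<close>

definition gram_pairing :: "nat \<Rightarrow> nat \<Rightarrow> 'a::euclidean_space dform \<Rightarrow> 'a dform" where
  "gram_pairing p q \<omega> xs ys
     = (\<Sum>bs\<in>basis_lists p. \<Sum>cs\<in>basis_lists q. \<omega> bs cs * gram (bs @ xs) (cs @ ys))"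

text \<open>
  On forms of bidegree \<open>(p, q)\<close> the sign is \<open>(-1)\<^bsup>(p - r)(q - r)\<^esup>\<close>, which moves the
  \<open>q - r\<close> remaining extra columns past the \<open>p - r\<close> arguments inserted into \<open>\<omega>\<close>.
\<close>

definition contraction_term :: "nat \<Rightarrow> 'a::euclidean_space dform \<Rightarrow> 'a dform" where
  "contraction_term r \<omega> xs ys = shuffle_sum xs (\<lambda>u' u. shuffle_sum ys (\<lambda>v' v.
     (- 1) ^ (length u' * length v') * (contraction ^^ r) \<omega> v' u' * gram u v))"

text \<open>Expand along the first extra row. A column among the \<open>q\<close> extra ones
  contracts \<open>\<omega>\<close>; a column \<open>y\<close> of \<open>ys\<close> is inserted into
  \<open>\<omega>\<close> after passing all \<open>q\<close> extra columns. For \<open>q = 0\<close>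
  the factor \<open>q\<close> makes the truncated \<open>q - 1\<close> irrelevant.\<close>

lemma gram_pairing_Suc:
  assumes "\<omega> \<in> double_forms (Suc p) q"
  shows "gram_pairing (Suc p) q \<omega> xs ys = q * gram_pairing p (q - 1) (contraction \<omega>) xs ys
    + (- 1) ^ q * del_sum ys (\<lambda>y zs. gram_pairing p q (\<lambda>us. \<omega> (y # us)) xs zs)"
proof -
  have sk: "skew (\<omega> us)" for us
    using assms alt_forms_skew unfolding double_forms_def by blast
  have ml: "multilinear (\<lambda>us. \<omega> us vs)" for vs
    using assms alt_forms_multilinear unfolding double_forms_def by blast
  have contr: "(\<Sum>cs\<in>basis_lists q. del_sum cs (\<lambda>z zs. \<omega> (z # bs) cs * gram (bs @ xs) (zs @ ys)))
      = q * (\<Sum>cs\<in>basis_lists (q - 1). contraction \<omega> bs cs * gram (bs @ xs) (cs @ ys))" for bs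
  proof (cases q)
    case 0
    then show ?thesis by (simp add: sum_basis_lists_0)
  next
    case (Suc q')
    have "\<omega> us (l @ a # b # r) * t = - (\<omega> us (l @ b # a # r) * t)" for us l a b r t
      using sk unfolding skew_def by (metis mult_minus_left)
    then have "skew (\<lambda>cs. \<omega> (z # bs) cs * gram (bs @ xs) (zs @ ys))" for z zs
      unfolding skew_def by blast
    note * = sum_basis_lists_del_sum[of "\<lambda>z zs cs. \<omega> (z # bs) cs * gram (bs @ xs) (zs @ ys)", OF this]
    show ?thesis
      unfolding Suc * contraction_def sum_distrib_right diff_Suc_1 by (subst sum.swap) simp
  qed
  have "gram_pairing (Suc p) q \<omega> xs ys = (\<Sum>bs\<in>basis_lists p. \<Sum>cs\<in>basis_lists q. \<Sum>b\<in>Basis.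
      del_sum (cs @ ys) (\<lambda>z zs. (b \<bullet> z) * \<omega> (b # bs) cs * gram (bs @ xs) zs))"
    unfolding gram_pairing_def sum_basis_lists_Suc
    by (subst sum.swap, rule sum.cong[OF refl], subst sum.swap) (simp add: mult_ac flip: del_sum_mult)
  also have "\<dots> = (\<Sum>bs\<in>basis_lists p. \<Sum>cs\<in>basis_lists q.
      del_sum (cs @ ys) (\<lambda>z zs. \<omega> (z # bs) cs * gram (bs @ xs) zs))"
    by (simp add: multilinear_expand_Basis[OF ml] flip: del_sum_sum sum_distrib_right)
  also have "\<dots> = (\<Sum>bs\<in>basis_lists p. (\<Sum>cs\<in>basis_lists q.
        del_sum cs (\<lambda>z zs. \<omega> (z # bs) cs * gram (bs @ xs) (zs @ ys)))
      + (- 1) ^ q * (\<Sum>cs\<in>basis_lists q. del_sum ys (\<lambda>z zs. \<omega> (z # bs) cs * gram (bs @ xs) (cs @ zs))))"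
    unfolding del_sum_append sum.distrib sum_distrib_left
    by (simp add: length_basis_lists)
  also have "\<dots> = (\<Sum>bs\<in>basis_lists p. \<Sum>cs\<in>basis_lists q.
        del_sum cs (\<lambda>z zs. \<omega> (z # bs) cs * gram (bs @ xs) (zs @ ys)))
      + (- 1) ^ q * del_sum ys (\<lambda>y zs. gram_pairing p q (\<lambda>us. \<omega> (y # us)) xs zs)"
    by (simp add: gram_pairing_def del_sum_sum sum.distrib flip: sum_distrib_left)
  finally show ?thesis by (simp add: contr gram_pairing_def sum_distrib_left)
qed

text \<open>Inserting \<open>y\<close> lengthens \<open>v'\<close> by one, and the resulting signs
  cancel. Euler's identity then gives the factor \<open>length v'\<close>, which is
  \<open>p - r\<close> wherever \<open>c^r \<omega>\<close> is nonzero; for \<open>r > p\<close>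
  both sides are 0.\<close>

lemma del_sum_contraction_term:
  fixes \<omega> :: "'a::euclidean_space dform"
  assumes "\<omega> \<in> double_forms p q"
  shows "(- 1) ^ q * del_sum ys (\<lambda>y zs. contraction_term r (\<lambda>us. \<omega> (y # us)) xs zs)
    = (real p - real r) * contraction_term r \<omega> xs ys"
proof -
  define \<Phi> :: "'a list \<Rightarrow> 'a list \<Rightarrow> 'a dform" where "\<Phi> u' u v' v
    = (- 1) ^ (length u' * length v') * (contraction ^^ r) \<omega> v' u' * gram u v" for u' u v' v
  have sk: "skew (\<lambda>v'. \<Phi> u' u v' v)" for u' u v
  proof -
    have "skew (\<lambda>us. (contraction ^^ r) \<omega> us vs)" for vs
      using funpow_contraction_double_forms[OF assms, of r] alt_forms_skew
      unfolding double_forms_def by blast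
    then have swap: "(contraction ^^ r) \<omega> (l @ a # b # s) vs = - (contraction ^^ r) \<omega> (l @ b # a # s) vs"
      for l a b s vs unfolding skew_def by blast
    show ?thesis unfolding skew_def \<Phi>_def by (intro allI, subst swap) simp
  qed
  have "(- 1) ^ q * ((- 1) ^ (length u' * length v') * (contraction ^^ r) (\<lambda>us. \<omega> (y # us)) v' u' * gram u v)
      = \<Phi> u' u (y # v') v" for u' u v' v y
  proof (cases "(contraction ^^ r) \<omega> (y # v') u' = 0")
    case True
    then show ?thesis by (simp add: \<Phi>_def funpow_contraction_Cons[OF assms])
  next
    case False
    \<comment> \<open>Hence \<open>(-1)^q\<close>, together with the \<open>(-1)^r\<close> from
      moving \<open>y\<close> past the contractions, is the sign \<open>(-1)^(length u')\<close> by
      which the two exponents differ.\<close>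
    then have q: "q = length u' + r" using funpow_contraction_degree[OF assms] by simp
    show ?thesis
      by (simp add: \<Phi>_def funpow_contraction_Cons[OF assms] q power_add)
  qed
  then have "(- 1) ^ q * del_sum ys (\<lambda>y zs. contraction_term r (\<lambda>us. \<omega> (y # us)) xs zs)
      = del_sum ys (\<lambda>y zs. shuffle_sum xs (\<lambda>u' u. shuffle_sum zs (\<lambda>v' v. \<Phi> u' u (y # v') v)))"
    unfolding contraction_term_def by (simp flip: del_sum_mult shuffle_sum_mult)
  also have "\<dots> = shuffle_sum xs (\<lambda>u' u. shuffle_sum ys (\<lambda>v' v. length v' * \<Phi> u' u v' v))"
    by (simp add: del_sum_shuffle_sum_swap shuffle_sum_euler[OF sk])
  also have "\<dots> = shuffle_sum xs (\<lambda>u' u. shuffle_sum ys (\<lambda>v' v. (real p - real r) * \<Phi> u' u v' v))"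
  proof (intro shuffle_sum_cong)
    fix u' u v' v
    show "length v' * \<Phi> u' u v' v = (real p - real r) * \<Phi> u' u v' v"
      using funpow_contraction_degree[OF assms, of r v' u'] by (auto simp: \<Phi>_def)
  qed
  finally show ?thesis by (simp add: shuffle_sum_mult contraction_term_def \<Phi>_def)
qed

text \<open>With \<open>t r\<close> for the term divided by \<open>fact r\<close>, the contraction
  part of the recursion yields the sum of \<open>r * t r\<close> and the insertion part the sum of
  \<open>(Suc p - r) * t r\<close>. Together they are \<open>Suc p\<close> times the sum of
  \<open>t r\<close>.\<close>

lemma gram_pairing_eq:
  assumes "\<omega> \<in> double_forms p q"
  shows "gram_pairing p q \<omega> xs ys
    = fact p * fact q * (\<Sum>r\<le>p. contraction_term r \<omega> xs ys / fact r)"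
  using assms
proof (induction p arbitrary: q \<omega> ys)
  case 0
  have deg: "\<omega> v' u' = 0" if "v' \<noteq> []" for v' u'
    using double_forms_degree[OF 0, of v' u'] that by auto
  have "shuffle_sum ys (\<lambda>v' v. (- 1) ^ (length u' * length v') * \<omega> v' u' * gram u v)
      = shuffle_sum ys (\<lambda>v' v. if v' = [] then \<omega> [] u' * gram u v else 0)" for u' u
    by (rule shuffle_sum_cong) (simp add: deg)
  then have "contraction_term 0 \<omega> xs ys = shuffle_sum xs (\<lambda>u' u. \<omega> [] u' * gram u ys)"
    by (simp add: contraction_term_def shuffle_sum_Nil_left)
  moreover have "\<omega> [] \<in> alt_forms q" using 0 unfolding double_forms_def by auto
  ultimately show ?case
    by (simp add: gram_pairing_def sum_basis_lists_0 sum_basis_lists_gram_append_right)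
next
  case (Suc p)
  let ?R = "\<lambda>r. contraction_term r \<omega> xs ys"
  have con: "contraction \<omega> \<in> double_forms p (q - 1)"
    using contraction_double_forms[OF Suc.prems] by simp
  have term_Suc: "contraction_term r (contraction \<omega>) xs ys = ?R (Suc r)" for r
    by (simp add: contraction_term_def funpow_swap1)
  have 1: "q * gram_pairing p (q - 1) (contraction \<omega>) xs ys
      = fact p * fact q * (\<Sum>r\<le>p. ?R (Suc r) / fact r)"
  \<comment> \<open>For \<open>q = 0\<close> the left side has the factor 0, and on the right every
    contraction of \<open>\<omega>\<close> is 0.\<close>
  proof (cases q)
    case 0
    have "(contraction ^^ Suc r) \<omega> v' u' = 0" for r u' v'
      using funpow_contraction_degree[OF Suc.prems, of "Suc r" v' u'] 0 by auto
    then have "?R (Suc r) = 0" for r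
      unfolding contraction_term_def by (simp add: shuffle_sum_0 del: funpow.simps)
    then show ?thesis using 0 by simp
  next
    case (Suc q')
    then show ?thesis using Suc.IH[OF con] by (simp add: term_Suc)
  qed
  have "(- 1) ^ q * del_sum ys (\<lambda>y zs. gram_pairing p q (\<lambda>us. \<omega> (y # us)) xs zs)
      = fact p * fact q * (\<Sum>r\<le>p. ((- 1) ^ q *
          del_sum ys (\<lambda>y zs. contraction_term r (\<lambda>us. \<omega> (y # us)) xs zs)) / fact r)"
    using Suc.IH[OF double_forms_Cons[OF Suc.prems, simplified]]
    by (simp add: divide_inverse del_sum_mult del_sum_sum sum_distrib_left mult_ac
        flip: del_sum_mult)
  also have "\<dots> = fact p * fact q * (\<Sum>r\<le>p. (real (Suc p) - real r) * ?R r / fact r)"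
    by (simp only: del_sum_contraction_term[OF Suc.prems])
  \<comment> \<open>The added term \<open>r = Suc p\<close> has coefficient 0.\<close>
  also have "(\<Sum>r\<le>p. (real (Suc p) - real r) * ?R r / fact r)
      = (\<Sum>r\<le>Suc p. (real (Suc p) - real r) * (?R r / fact r))"
    by simp
  finally have 2: "(- 1) ^ q * del_sum ys (\<lambda>y zs. gram_pairing p q (\<lambda>us. \<omega> (y # us)) xs zs)
      = fact p * fact q * (\<Sum>r\<le>Suc p. (real (Suc p) - real r) * (?R r / fact r))" .
  \<comment> \<open>Index shift with \<open>1 / fact r = Suc r / fact (Suc r)\<close>; the new term
    \<open>r = 0\<close> is 0.\<close>
  have 3: "(\<Sum>r\<le>p. ?R (Suc r) / fact r) = (\<Sum>r\<le>Suc p. real r * (?R r / fact r))"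
    by (subst sum.atMost_Suc_shift) (simp add: divide_simps)
  have 4: "r * t + (real (Suc p) - r) * t = real (Suc p) * t" for r t
    by (simp add: algebra_simps)
  show ?case
    unfolding gram_pairing_Suc[OF Suc.prems] 1 2 3 distrib_left[symmetric] sum.distrib[symmetric] 4
      sum_distrib_left[symmetric]
    by simp
qed

section \<open>The formula for the Hodge star\<close>

text \<open>The two reordering signs are equal, because each factor lives on pairs of lists of equal
  length, and so they cancel.\<close>

lemma dmult_commute:
  assumes "\<And>us vs. \<omega> us vs \<noteq> 0 \<Longrightarrow> length us = length vs"
    and "\<And>us vs. \<eta> us vs \<noteq> 0 \<Longrightarrow> length us = length vs"
  shows "dmult \<omega> \<eta> xs ys = dmult \<eta> \<omega> xs ys"
proof -
  have "dmult \<omega> \<eta> xs ys = shuffle_sum xs (\<lambda>u' u. (- 1) ^ (length u' * length u) *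
      shuffle_sum ys (\<lambda>v v'. \<omega> u v * \<eta> u' v'))"
    unfolding dmult_shuffle_sum
    by (rule shuffle_sum_flip[of xs "\<lambda>u' u. shuffle_sum ys (\<lambda>v v'. \<omega> u v * \<eta> u' v')"])
  also have "\<dots> = shuffle_sum xs (\<lambda>u' u. shuffle_sum ys (\<lambda>v' v.
      (- 1) ^ (length u' * length u) * ((- 1) ^ (length v' * length v) * (\<omega> u v * \<eta> u' v'))))"
    unfolding shuffle_sum_mult
    by (simp only: shuffle_sum_flip[of ys "\<lambda>v' v. \<omega> _ v * \<eta> _ v'"])
  also have "\<dots> = dmult \<eta> \<omega> xs ys"
    unfolding dmult_shuffle_sum
  proof (intro shuffle_sum_cong)
    fix u' u v' v
    show "(- 1) ^ (length u' * length u) * ((- 1) ^ (length v' * length v) * (\<omega> u v * \<eta> u' v'))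
      = \<eta> u' v' * \<omega> u v"
      using assms(1)[of u v] assms(2)[of u' v']
      by (cases "\<omega> u v = 0 \<or> \<eta> u' v' = 0") (auto simp: mult_ac simp flip: power_add)
  qed
  finally show ?thesis .
qed

lemma dmult_scale_left: "dmult (\<lambda>us vs. c * \<omega> us vs) \<eta> xs ys = c * dmult \<omega> \<eta> xs ys"
  by (simp add: dmult_shuffle_sum mult.assoc shuffle_sum_mult)

lemma dhodge_scale: "dhodge vol (\<lambda>us vs. c * \<omega> us vs) xs ys = c * dhodge vol \<omega> xs ys"
  by (simp add: dhodge_def Let_def sum_distrib_left mult.assoc)

lemma dmult_degree:
  fixes \<omega> \<eta> :: "'a dform"
  assumes "\<And>us vs. \<omega> us vs \<noteq> 0 \<Longrightarrow> length us = a \<and> length vs = a"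
    and "\<And>us vs. \<eta> us vs \<noteq> 0 \<Longrightarrow> length us = b \<and> length vs = b"
    and "dmult \<omega> \<eta> xs ys \<noteq> 0"
  shows "length xs = a + b \<and> length ys = a + b"
proof (rule ccontr)
  assume *: "\<not> ?thesis"
  have "dmult \<omega> \<eta> xs ys = 0"
    unfolding dmult_shuffle_sum
  proof (intro shuffle_sum_0)
    fix u u' v v' :: "'a list"
    assume "length u + length u' = length xs" "length v + length v' = length ys"
    then have "\<not> (length u = a \<and> length v = a \<and> length u' = b \<and> length v' = b)" using * by auto
    then have "\<omega> u v = 0 \<or> \<eta> u' v' = 0" using assms(1)[of u v] assms(2)[of u' v'] by blast
    then show "\<omega> u v * \<eta> u' v' = 0" by auto
  qed
  with assms(3) show False by simp
qed

lemma dmult_dunit_left: "dmult dunit \<omega> xs ys = \<omega> xs ys"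
proof -
  have "shuffle_sum ys (\<lambda>v v'. dunit u v * \<omega> u' v') = (if u = [] then \<omega> u' ys else 0)" for u u'
    unfolding shuffle_sum_Nil_left[of ys "\<lambda>v'. if u = [] then \<omega> u' v' else 0", symmetric]
    by (rule shuffle_sum_cong) (simp add: dunit_def)
  then show ?thesis by (simp add: dmult_shuffle_sum shuffle_sum_Nil_left[of xs "\<lambda>u'. \<omega> u' ys"])
qed

text \<open>The divided power \<open>g^m / m!\<close>; the condition on the length selects degree
  \<open>m\<close>, since \<open>gram\<close> covers all degrees at once.\<close>

definition gram_form :: "nat \<Rightarrow> 'a::euclidean_space dform" where
  "gram_form m us vs = (if length us = m then gram us vs else 0)"

lemma dpow_metric_form_eq: "dpow metric_form m = (\<lambda>us vs. fact m * gram_form m us vs)"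
  by (intro ext) (simp add: dpow_metric_form gram_form_def)

lemma gram_form_degree: "gram_form m us vs \<noteq> 0 \<Longrightarrow> length us = m \<and> length vs = m"
  using gram_degree unfolding gram_form_def by (metis (full_types))

lemma dmult_gram_form_degree:
  assumes "\<And>us vs. \<eta> us vs \<noteq> 0 \<Longrightarrow> length us = b \<and> length vs = b"
    and "dmult (gram_form m) \<eta> xs ys \<noteq> 0"
  shows "length xs = m + b \<and> length ys = m + b"
  using gram_form_degree assms by (rule dmult_degree)

text \<open>Symmetry of \<open>\<omega>\<close> undoes the transposition, and both inserted parts
  have length \<open>p - r\<close>, whose square has the parity of \<open>r + p\<close>. If
  \<open>p > m + r\<close>, then \<open>xs\<close> is too short to supply \<open>p - r\<close>
  arguments.\<close>

lemma contraction_term_eq: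
  assumes "\<omega> \<in> C1 p" "length xs = m" "r \<le> p"
  shows "contraction_term r \<omega> xs ys
    = (if p \<le> m + r then (- 1) ^ (r + p) * dmult (gram_form (m + r - p)) ((contraction ^^ r) \<omega>) xs ys else 0)"
proof -
  have \<omega>: "\<omega> \<in> double_forms p p" and sym: "\<And>us vs. \<omega> us vs = \<omega> vs us"
    using assms(1) unfolding C1_def by auto
  note deg = funpow_contraction_degree[OF \<omega>]
  have csym: "(contraction ^^ r) \<omega> us vs = (contraction ^^ r) \<omega> vs us" for us vs
    by (rule funpow_contraction_sym) (rule sym)
  have sgn: "(- 1 :: real) ^ (length u' * length v') * (contraction ^^ r) \<omega> v' u'
      = (- 1) ^ (r + p) * (contraction ^^ r) \<omega> u' v'"
    for u' v'
  proof (cases "(contraction ^^ r) \<omega> u' v' = 0")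
    case False
    then have "length u' + r = p" "length v' + r = p" using deg by blast+
    then show ?thesis
      by (auto simp: csym[of v' u'] uminus_power_if)
  qed (simp add: csym[of v' u'])
  have "contraction_term r \<omega> xs ys = (- 1) ^ (r + p) *
      shuffle_sum xs (\<lambda>u' u. shuffle_sum ys (\<lambda>v' v. (contraction ^^ r) \<omega> u' v' * gram u v))"
    unfolding contraction_term_def sgn mult.assoc shuffle_sum_mult ..
  also have "shuffle_sum xs (\<lambda>u' u. shuffle_sum ys (\<lambda>v' v. (contraction ^^ r) \<omega> u' v' * gram u v))
    = (if p \<le> m + r then dmult ((contraction ^^ r) \<omega>) (gram_form (m + r - p)) xs ys else 0)"
  proof (cases "p \<le> m + r")
    case True
    then have *: "(contraction ^^ r) \<omega> u' v' * gram u v = (contraction ^^ r) \<omega> u' v' * gram_form (m + r - p) u v"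
      if "length u' + length u = length xs" for u u' v v'
      using that deg[of r u' v'] assms(2)
      by (cases "(contraction ^^ r) \<omega> u' v' = 0") (auto simp: gram_form_def)
    have "shuffle_sum xs (\<lambda>u' u. shuffle_sum ys (\<lambda>v' v. (contraction ^^ r) \<omega> u' v' * gram u v))
        = dmult ((contraction ^^ r) \<omega>) (gram_form (m + r - p)) xs ys"
      unfolding dmult_shuffle_sum by (intro shuffle_sum_cong *)
    then show ?thesis using True by simp
  next
    case False
    then have "(contraction ^^ r) \<omega> u' v' = 0" if "length u' + length u = length xs" for u u' v'
      using that deg[of r u' v'] assms(2) by auto
    then show ?thesis
      using False by (auto intro!: shuffle_sum_0)
  qed
  also have "dmult ((contraction ^^ r) \<omega>) (gram_form (m + r - p)) xs ys
      = dmult (gram_form (m + r - p)) ((contraction ^^ r) \<omega>) xs ys"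
    by (rule dmult_commute) (use deg gram_form_degree in fastforce)+
  finally show ?thesis by simp
qed

lemma dhodge_dmult_gram_form:
  fixes vol :: "'a::euclidean_space form" and \<omega> :: "'a dform"
  assumes vol: "unit_volume_form vol" and p: "1 \<le> p" and \<omega>: "\<omega> \<in> C1 p"
    and k: "p \<le> k" "k \<le> DIM('a)"
  shows "dhodge vol (dmult (gram_form (k - p)) \<omega>) xs ys
    = (\<Sum>r = p + k - DIM('a)..p. (- 1) ^ (r + p) / fact r *
        dmult (gram_form (DIM('a) - k + r - p)) ((contraction ^^ r) \<omega>) xs ys)"
proof (cases "length xs = DIM('a) - k \<and> length ys = DIM('a) - k")
  case True
  let ?m = "DIM('a) - k"
  have \<omega>': "\<omega> \<in> double_forms p p" using \<omega> unfolding C1_def by auto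
  have "dhodge vol (dmult (gram_form (k - p)) \<omega>) xs ys = gram_pairing p p \<omega> xs ys / (fact p * fact p)"
    using dhodge_dmult_gram[OF vol, of xs "k - p" p ys \<omega>] True k
    unfolding gram_pairing_def gram_form_def[abs_def] by simp
  also have "\<dots> = (\<Sum>r\<le>p. contraction_term r \<omega> xs ys / fact r)"
    by (simp add: gram_pairing_eq[OF \<omega>'])
  \<comment> \<open>Below the lower limit \<open>p > ?m + r\<close>, so these terms vanish. The
    truncated subtraction is the maximum with 0.\<close>
  also have "\<dots> = (\<Sum>r = p + k - DIM('a)..p. contraction_term r \<omega> xs ys / fact r)"
    by (rule sum.mono_neutral_right) (use True k in \<open>auto simp: contraction_term_eq[OF \<omega>]\<close>)
  also have "\<dots> = (\<Sum>r = p + k - DIM('a)..p. (- 1) ^ (r + p) / fact r *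
        dmult (gram_form (?m + r - p)) ((contraction ^^ r) \<omega>) xs ys)"
    by (rule sum.cong) (use True k in \<open>auto simp: contraction_term_eq[OF \<omega>]\<close>)
  finally show ?thesis .
next
  case False
  have \<omega>': "\<omega> \<in> double_forms p p" using \<omega> unfolding C1_def by auto
  \<comment> \<open>The product has bidegree \<open>(k, k)\<close>. Lists longer than
    \<open>n\<close> make the truncated difference 0, which is not \<open>k\<close> because
    \<open>1 \<le> p \<le> k\<close>.\<close>
  have "dmult (gram_form (k - p)) \<omega> bs cs = 0"
    if "length bs = DIM('a) - length xs" "length cs = DIM('a) - length ys" for bs cs
    using dmult_gram_form_degree[of \<omega> p "k - p" bs cs, OF double_forms_degree[OF \<omega>']] False that p k
    by (cases "dmult (gram_form (k - p)) \<omega> bs cs = 0") auto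
  then have "dhodge vol (dmult (gram_form (k - p)) \<omega>) xs ys = 0"
    unfolding dhodge_def Let_def by (auto intro!: sum.neutral simp: length_basis_lists)
  moreover have "dmult (gram_form (DIM('a) - k + r - p)) ((contraction ^^ r) \<omega>) xs ys = 0"
    if "r \<in> {p + k - DIM('a)..p}" for r
  proof -
    have "(contraction ^^ r) \<omega> us vs \<noteq> 0 \<Longrightarrow> length us = p - r \<and> length vs = p - r" for us vs
      using funpow_contraction_degree[OF \<omega>', of r us vs] by auto
    from dmult_gram_form_degree[of "(contraction ^^ r) \<omega>" "p - r" "DIM('a) - k + r - p" xs ys, OF this]
    show ?thesis using False that k
      by (cases "dmult (gram_form (DIM('a) - k + r - p)) ((contraction ^^ r) \<omega>) xs ys = 0") auto
  qed
  ultimately show ?thesis by simp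
qed

theorem theorem4p1:
  fixes vol :: "'a::euclidean_space form" and \<omega> :: "'a dform" and n p :: nat
  assumes "n = DIM('a)"
    and "unit_volume_form vol"
    and "1 \<le> p" and "p \<le> n"
    and "\<omega> \<in> C1 p"
  shows "(\<forall>k. p \<le> k \<and> k \<le> n \<longrightarrow> (\<forall>xs ys.
            1 / fact (k - p) * dhodge vol (dmult (dpow metric_form (k - p)) \<omega>) xs ys =
            (\<Sum>r = max 0 (p + k - n)..p. (- 1) ^ (r + p) / fact r *
               dmult (\<lambda>us vs. dpow metric_form (n - k + r - p) us vs / fact (n - k + r - p))
                     ((contraction ^^ r) \<omega>) xs ys)))
       \<and> (\<forall>xs ys.
            dhodge vol (\<lambda>us vs. dmult (dpow metric_form (n - p)) \<omega> us vs / fact (n - p)) xs ys =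
            1 / fact p * (contraction ^^ p) \<omega> xs ys)
       \<and> (p \<le> n - 1 \<longrightarrow> (\<forall>xs ys.
            dhodge vol (\<lambda>us vs. dmult (dpow metric_form (n - p - 1)) \<omega> us vs / fact (n - p - 1)) xs ys =
            dmult (\<lambda>us vs. (contraction ^^ p) \<omega> us vs / fact p) metric_form xs ys
              - (contraction ^^ (p - 1)) \<omega> xs ys / fact (p - 1)))"
proof -
  have norm: "(\<lambda>us vs. dpow metric_form m us vs / fact m) = (gram_form m :: 'a dform)" for m
    by (simp add: dpow_metric_form_eq)
  have dm: "dmult (dpow metric_form m) \<omega> = (\<lambda>us vs. fact m * dmult (gram_form m) \<omega> us vs)" for m
    by (intro ext) (simp add: dpow_metric_form_eq dmult_scale_left)
  note main = dhodge_dmult_gram_form[OF assms(2,3,5), folded assms(1)]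
  have g0: "(gram_form 0 :: 'a dform) = dunit"
    using norm[of 0] by simp
  have g1: "(gram_form 1 :: 'a dform) = metric_form"
    by (intro ext) (auto simp: gram_form_def metric_form_case length_Suc_conv inner_commute del_sum_0 split: list.split)
  have \<omega>: "\<omega> \<in> double_forms p p" using assms(5) unfolding C1_def by auto
  have "1 / fact (k - p) * dhodge vol (dmult (dpow metric_form (k - p)) \<omega>) xs ys =
      (\<Sum>r = max 0 (p + k - n)..p. (- 1) ^ (r + p) / fact r *
         dmult (\<lambda>us vs. dpow metric_form (n - k + r - p) us vs / fact (n - k + r - p))
               ((contraction ^^ r) \<omega>) xs ys)" if "p \<le> k" "k \<le> n" for k xs ys
    unfolding dm dhodge_scale norm main[OF that] by simp
  \<comment> \<open>For \<open>k = n\<close> the lower limit is \<open>p\<close>: only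
    \<open>r = p\<close> remains, with the unit \<open>g^0\<close>.\<close>
  moreover have "dhodge vol (\<lambda>us vs. dmult (dpow metric_form (n - p)) \<omega> us vs / fact (n - p)) xs ys =
      1 / fact p * (contraction ^^ p) \<omega> xs ys" for xs ys
    using main[of n xs ys] assms(4) by (simp add: dm g0 dmult_dunit_left)
  moreover have "dhodge vol (\<lambda>us vs. dmult (dpow metric_form (n - p - 1)) \<omega> us vs / fact (n - p - 1)) xs ys =
      dmult (\<lambda>us vs. (contraction ^^ p) \<omega> us vs / fact p) metric_form xs ys
        - (contraction ^^ (p - 1)) \<omega> xs ys / fact (p - 1)" if "p \<le> n - 1" for xs ys
  proof -
    obtain q where p: "p = Suc q" using assms(3) by (cases p) auto
    \<comment> \<open>For \<open>k = n - 1\<close> the sum runs over \<open>r = q\<close> with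
      \<open>g^0\<close> and sign -1, and \<open>r = p\<close> with \<open>g^1\<close> and sign
      1.\<close>
    have n: "p + (n - 1) - n = q" "n - (n - 1) = 1" "n - 1 - p = n - p - 1" using that p by auto
    have "dhodge vol (dmult (gram_form (n - p - 1)) \<omega>) xs ys
        = dmult metric_form ((contraction ^^ p) \<omega>) xs ys / fact p - (contraction ^^ q) \<omega> xs ys / fact q"
      using main[of "n - 1" xs ys] that unfolding n(1,3) unfolding n(2)
      by (simp add: p g0 g1[simplified] dmult_dunit_left del: funpow.simps fact_Suc)
    moreover have "dmult metric_form ((contraction ^^ p) \<omega>) xs ys
        = dmult ((contraction ^^ p) \<omega>) metric_form xs ys"
      unfolding g1[symmetric]
      by (rule dmult_commute) (use funpow_contraction_degree[OF \<omega>] gram_form_degree in fastforce)+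
    ultimately show ?thesis
      using dmult_scale_left[of "1 / fact p" "(contraction ^^ p) \<omega>" metric_form xs ys]
      by (simp add: dm p del: funpow.simps fact_Suc)
  qed
  ultimately show ?thesis by blast
qed

end
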